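(* For $i=1,2$, let $S_i$ be a symmetric finite generating set of a group $G_i$, and let $N_i$ be a finite normal subgroup of $G_i$ such that $G_i/N_i$ is torsion-free nilpotent. Let $\varphi$ be a graph isomorphism from $\mathrm{Cay}(G_1;S_1)$ to $\mathrm{Cay}(G_2;S_2)$. Then $\varphi$ induces a well-defined map $\overline\varphi\colon G_1/N_1\to G_2/N_2$, $\overline\varphi(xN_1)=\varphi(x)N_2$, and $\overline\varphi$ is an affine bijection.
   Context: $\mathrm{Cay}(G;S)$ is the graph with vertex set $G$ in which $g$ is adjacent to $gs$ for all $g\in G$, $s\in S$. A map $\psi\colon H_1\to H_2$ between groups is an affine bijection if there exist a group isomorphism $\alpha\colon H_1\to H_2$ and $h\in H_2$ with $\psi(x)=h\,\alpha(x)$ for all $x\in H_1$. *)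

theory Defs
  imports "HOL-Algebra.Generated_Groups"
begin

text \<open>A graph is a vertex set together with its adjacency relation, given as a set of ordered
  pairs; a loop at every vertex is present in the Cayley graph exactly when the identity lies
  in \<open>S\<close>.\<close>

type_synonym 'a graph = "'a set \<times> ('a \<times> 'a) set"

definition Cay :: "('a, 'm) monoid_scheme \<Rightarrow> 'a set \<Rightarrow> 'a graph" where
  "Cay G S = (carrier G, {(g, g \<otimes>\<^bsub>G\<^esub> s) | g s. g \<in> carrier G \<and> s \<in> S})"

text \<open>Only the values of \<open>f\<close> on the vertices of the first graph matter.\<close>

definition graph_isomorphism :: "'a graph \<Rightarrow> 'b graph \<Rightarrow> ('a \<Rightarrow> 'b) \<Rightarrow> bool" where
  "graph_isomorphism X Y f \<longleftrightarrow>
     bij_betw f (fst X) (fst Y) \<and>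
     (\<forall>u \<in> fst X. \<forall>v \<in> fst X. (u, v) \<in> snd X \<longleftrightarrow> (f u, f v) \<in> snd Y)"

definition symmetric_finite_generating_set :: "('a, 'm) monoid_scheme \<Rightarrow> 'a set \<Rightarrow> bool" where
  "symmetric_finite_generating_set G S \<longleftrightarrow>
     S \<subseteq> carrier G \<and> finite S \<and> (\<forall>s \<in> S. inv\<^bsub>G\<^esub> s \<in> S) \<and> generate G S = carrier G"

definition torsion_free :: "('a, 'm) monoid_scheme \<Rightarrow> bool" where
  "torsion_free G \<longleftrightarrow>
     (\<forall>x \<in> carrier G. \<forall>n::nat. n > 0 \<longrightarrow> x [^]\<^bsub>G\<^esub> n = \<one>\<^bsub>G\<^esub> \<longrightarrow> x = \<one>\<^bsub>G\<^esub>)"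

text \<open>The indexing starts at 0, with the whole group as the zeroth term.\<close>

fun lower_central :: "('a, 'm) monoid_scheme \<Rightarrow> nat \<Rightarrow> 'a set" where
  "lower_central G 0 = carrier G"
| "lower_central G (Suc n) =
     generate G (\<Union>x \<in> lower_central G n. \<Union>y \<in> carrier G.
       {x \<otimes>\<^bsub>G\<^esub> y \<otimes>\<^bsub>G\<^esub> inv\<^bsub>G\<^esub> x \<otimes>\<^bsub>G\<^esub> inv\<^bsub>G\<^esub> y})"

definition nilpotent :: "('a, 'm) monoid_scheme \<Rightarrow> bool" where
  "nilpotent G \<longleftrightarrow> (\<exists>n. lower_central G n = {\<one>\<^bsub>G\<^esub>})"

definition affine_bijection ::
  "('a, 'm) monoid_scheme \<Rightarrow> ('b, 'n) monoid_scheme \<Rightarrow> ('a \<Rightarrow> 'b) \<Rightarrow> bool" where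
  "affine_bijection H\<^sub>1 H\<^sub>2 \<psi> \<longleftrightarrow>
     (\<exists>\<alpha> \<in> iso H\<^sub>1 H\<^sub>2. \<exists>h \<in> carrier H\<^sub>2. \<forall>x \<in> carrier H\<^sub>1. \<psi> x = h \<otimes>\<^bsub>H\<^sub>2\<^esub> \<alpha> x)"

end

theory Submission
  imports Defs "HOL-Algebra.FiniteProduct"
begin

text \<open>
  Let \<open>Z\<^sub>0 = N \<subseteq> Z\<^sub>1 \<subseteq> \<dots> \<subseteq> Z\<^sub>c = G\<close> be the preimages in \<open>G\<close> of the upper central series of \<open>G/N\<close>; all
  factors \<open>Z\<^bsub>i+1\<^esub>/Z\<^sub>i\<close> are torsion-free abelian. Let \<open>f\<close> be an automorphism of \<open>Cay(G;S)\<close> whose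
  displacement \<open>D(x) = x\<inverse> f(x)\<close> takes finitely many values modulo \<open>Z\<^sub>j\<close>. Going down the series, suppose
  that \<open>D\<close> is constant modulo \<open>Z\<^bsub>i+1\<^esub>\<close> with value \<open>d \<in> Z\<^bsub>i+2\<^esub>\<close>. As \<open>f\<close> permutes the neighbours, the
  \<open>Z\<^bsub>i+1\<^esub>/Z\<^sub>i\<close>-valued function \<open>d\<inverse> D\<close> is harmonic, and since its range is finite, an extreme point of the
  range and the maximum principle show that it is constant. So \<open>D\<close> is constant modulo \<open>Z\<^sub>i\<close>, with
  value \<open>d'\<close> say; conjugation by \<open>d'\<close> then permutes \<open>S\<close> modulo \<open>Z\<^sub>i\<close>, so a power of \<open>d'\<close> and hence \<open>d'\<close>
  itself lies in \<open>Z\<^bsub>i+1\<^esub>\<close>. In the end \<open>f\<close> is, modulo \<open>Z\<^sub>j\<close>, multiplication by an element of \<open>Z\<^bsub>j+1\<^esub>\<close>.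

  Applied to \<open>\<phi> L\<^sub>z \<phi>\<inverse>\<close> with \<open>z \<in> Z\<^bsub>j+1\<^esub>\<close>, this shows inductively that \<open>\<phi>\<close> maps cosets of \<open>Z\<^sub>j(G\<^sub>1)\<close> to
  cosets of \<open>Z\<^sub>j(G\<^sub>2)\<close>. If \<open>\<phi>(1) = 1\<close>, then \<open>f = L\<^bsub>\<phi>(g)\<^esub>\<inverse> \<phi> L\<^sub>g \<phi>\<inverse>\<close> fixes \<open>1\<close>, so the iterates \<open>f\<^sup>k(y)\<close> stay
  in a finite set, whereas \<open>f\<^sup>k(y) \<equiv> y D(y)\<^sup>k\<close> modulo \<open>Z\<^sub>j\<close> as soon as \<open>D\<close> has values in \<open>Z\<^bsub>j+1\<^esub>\<close>; hence
  \<open>D(y) \<in> Z\<^sub>j\<close>. Descending to \<open>Z\<^sub>0 = N\<close> yields \<open>\<phi>(gx) \<equiv> \<phi>(g) \<phi>(x)\<close> modulo \<open>N\<^sub>2\<close>.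
\<close>

section \<open>Extreme points in torsion-free abelian groups\<close>

lemma (in comm_group) finprod_nat_pow:
  assumes "f \<in> A \<rightarrow> carrier G"
  shows "(\<Otimes>x\<in>A. f x) [^] (n::nat) = (\<Otimes>x\<in>A. f x [^] n)"
proof (induction n)
  case (Suc n)
  have "(\<Otimes>x\<in>A. f x [^] Suc n) = (\<Otimes>x\<in>A. f x [^] n \<otimes> f x)"
    by simp
  also have "\<dots> = (\<Otimes>x\<in>A. f x [^] n) \<otimes> (\<Otimes>x\<in>A. f x)"
    using assms by (intro finprod_multf) auto
  finally show ?case
    using Suc by simp
qed simp

lemma (in comm_group) torsion_free_nat_pow_inj:
  assumes "torsion_free G" "x \<in> carrier G" "y \<in> carrier G" "(n::nat) > 0" "x [^] n = y [^] n"
  shows "x = y"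
proof -
  have "(x \<otimes> inv y) [^] n = \<one>"
    using assms by (simp add: pow_mult_distrib m_comm nat_pow_inv)
  then have "x \<otimes> inv y = \<one>"
    using assms unfolding torsion_free_def by blast
  then show ?thesis
    using assms by (metis inv_equality inv_inv inv_closed)
qed

text \<open>An algebraic stand-in for a vertex of the convex hull: \<open>v\<close> is a weighted
  mean of points of \<open>F\<close> only trivially. Natural-number weights express means inside the
  group, and torsion-freeness plays the part of division.\<close>

lemma (in comm_group) extreme_point_weights:
  assumes tf: "torsion_free G" and F: "finite F" "F \<noteq> {}" "F \<subseteq> carrier G"
  shows "\<exists>v\<in>F. \<forall>a::'a \<Rightarrow> nat.
           (\<Otimes>w\<in>F. w [^] a w) = v [^] (\<Sum>w\<in>F. a w) \<longrightarrow> (\<forall>w\<in>F. w \<noteq> v \<longrightarrow> a w = 0)"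
  using F
proof (induction F rule: finite_ne_induct)
  case (singleton x)
  then show ?case by auto
next
  case (insert x F)
  have x: "x \<in> carrier G" and Fc: "F \<subseteq> carrier G"
    using insert.prems by auto
  obtain v where v: "v \<in> F"
    and ext: "\<And>a::'a \<Rightarrow> nat. (\<Otimes>w\<in>F. w [^] a w) = v [^] (\<Sum>w\<in>F. a w) \<Longrightarrow> (\<forall>w\<in>F. w \<noteq> v \<longrightarrow> a w = 0)"
    using insert.IH Fc by blast
  have vc: "v \<in> carrier G" and xv: "x \<noteq> v"
    using v Fc insert.hyps by auto
  have closed: "(\<lambda>w. w [^] a w) \<in> F \<rightarrow> carrier G" for a :: "'a \<Rightarrow> nat"
    using Fc by auto
  have prod_insert: "(\<Otimes>w\<in>insert x F. w [^] a w) = x [^] a x \<otimes> (\<Otimes>w\<in>F. w [^] a w)" for a :: "'a \<Rightarrow> nat"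
    using insert.hyps x closed by (subst finprod_insert) auto
  have sum_insert: "(\<Sum>w\<in>insert x F. a w) = a x + (\<Sum>w\<in>F. a w)" for a :: "'a \<Rightarrow> nat"
    using insert.hyps by simp
  show ?case
  proof (rule ccontr)
    \<comment> \<open>If \<open>v\<close> is no longer extreme after adding \<open>x\<close>, then \<open>x\<close> itself is extreme.\<close>
    assume no: "\<not> ?thesis"
    then obtain a :: "'a \<Rightarrow> nat" and w0 where a: "(\<Otimes>w\<in>insert x F. w [^] a w) = v [^] (\<Sum>w\<in>insert x F. a w)"
      and w0: "w0 \<in> insert x F" "w0 \<noteq> v" "a w0 \<noteq> 0"
      using v by blast
    obtain b :: "'a \<Rightarrow> nat" and w1 where b: "(\<Otimes>w\<in>insert x F. w [^] b w) = x [^] (\<Sum>w\<in>insert x F. b w)"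
      and w1: "w1 \<in> insert x F" "w1 \<noteq> x" "b w1 \<noteq> 0"
      using no by blast
    define A B where "A = (\<Sum>w\<in>F. a w)" and "B = (\<Sum>w\<in>F. b w)"
    define PA PB where "PA = (\<Otimes>w\<in>F. w [^] a w)" and "PB = (\<Otimes>w\<in>F. w [^] b w)"
    have Pc: "PA \<in> carrier G" "PB \<in> carrier G"
      unfolding PA_def PB_def using closed by auto
    have a': "x [^] a x \<otimes> PA = v [^] (a x + A)"
      using a unfolding prod_insert sum_insert PA_def A_def .
    have "x [^] b x \<otimes> PB = x [^] b x \<otimes> x [^] B"
      using b x unfolding prod_insert sum_insert PB_def B_def by (simp add: nat_pow_mult)
    then have PB: "PB = x [^] B"
      using Pc x by simp
    have ax: "a x \<noteq> 0"
    proof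
      assume "a x = 0"
      then have "PA = v [^] A"
        using a' Pc by simp
      then have "\<forall>w\<in>F. w \<noteq> v \<longrightarrow> a w = 0"
        unfolding PA_def A_def by (rule ext)
      then show False
        using w0 \<open>a x = 0\<close> by auto
    qed
    \<comment> \<open>Elimination of \<open>x\<close>: relation \<open>a'\<close> is raised to the
      power \<open>B\<close>, and \<open>x [^] B\<close> is replaced by \<open>PB\<close>. The
      result is a relation over \<open>F\<close> alone, to which \<open>ext\<close> applies.\<close>
    have "(\<Otimes>w\<in>F. w [^] (b w * a x + a w * B)) = (\<Otimes>w\<in>F. (w [^] b w) [^] a x \<otimes> (w [^] a w) [^] B)"
      using Fc by (intro finprod_cong') (auto simp: nat_pow_pow nat_pow_mult)
    also have "\<dots> = (\<Otimes>w\<in>F. (w [^] b w) [^] a x) \<otimes> (\<Otimes>w\<in>F. (w [^] a w) [^] B)"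
      using Fc by (intro finprod_multf) auto
    also have "\<dots> = PB [^] a x \<otimes> PA [^] B"
      unfolding PA_def PB_def using closed by (simp add: finprod_nat_pow)
    also have "\<dots> = (x [^] a x \<otimes> PA) [^] B"
      using Pc x PB by (simp add: pow_mult_distrib m_comm nat_pow_pow mult.commute)
    also have "\<dots> = v [^] ((a x + A) * B)"
      using a' vc by (simp add: nat_pow_pow)
    also have "(a x + A) * B = (\<Sum>w\<in>F. b w * a x + a w * B)"
      unfolding A_def B_def by (simp add: sum.distrib add_mult_distrib flip: sum_distrib_right)
    finally have "\<forall>w\<in>F. w \<noteq> v \<longrightarrow> b w * a x + a w * B = 0"
      by (rule ext)
    then have b0: "b w = 0" if "w \<in> F" "w \<noteq> v" for w
      using ax that by auto
    \<comment> \<open>As \<open>b\<close> vanishes on \<open>F\<close> away from \<open>v\<close>,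
      the relation for \<open>x\<close> collapses to \<open>x [^] B = v [^] B\<close>. Roots are
      unique, so \<open>B = 0\<close>, which contradicts \<open>w1\<close>.\<close>
    have "PB = (\<Otimes>w\<in>F. if w = v then v [^] b v else \<one>)"
      unfolding PB_def using vc b0 by (intro finprod_cong') auto
    also have "\<dots> = v [^] b v"
      using v insert.hyps vc by (subst finprod_singleton_swap) auto
    also have "b v = B"
      unfolding B_def using v b0 insert.hyps by (subst sum.remove[of F v]) auto
    finally have "x [^] B = v [^] B"
      using PB by simp
    then have "B = 0"
      using torsion_free_nat_pow_inj[OF tf x vc] xv by blast
    then show False
      using w1 insert.hyps unfolding B_def by auto
  qed
qed

lemma (in comm_group) finprod_group_by_value:
  assumes "finite I" "finite F" "F \<subseteq> carrier G" "u \<in> I \<rightarrow> F"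
  shows "(\<Otimes>i\<in>I. u i) = (\<Otimes>w\<in>F. w [^] card {i\<in>I. u i = w})"
  using assms(1,4)
proof (induction I rule: finite_induct)
  case empty
  then show ?case
    using assms(3) by (auto intro!: finprod_one_eqI[symmetric])
next
  case (insert j I)
  have uj: "u j \<in> F" "u j \<in> carrier G" and uI: "u \<in> I \<rightarrow> F"
    using insert.prems assms(3) by auto
  have card: "card {i \<in> insert j I. u i = w} = card {i\<in>I. u i = w} + (if w = u j then 1 else 0)" for w
  proof (cases "w = u j")
    case True
    then have "{i \<in> insert j I. u i = w} = insert j {i\<in>I. u i = w}" by auto
    then show ?thesis using True insert.hyps by simp
  next
    case False
    then have "{i \<in> insert j I. u i = w} = {i\<in>I. u i = w}" by auto
    then show ?thesis using False by simp
  qed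
  have "(\<Otimes>w\<in>F. w [^] card {i \<in> insert j I. u i = w})
      = (\<Otimes>w\<in>F. w [^] card {i\<in>I. u i = w} \<otimes> (if w = u j then u j else \<one>))"
    unfolding card using assms(3) uj by (intro finprod_cong') auto
  also have "\<dots> = (\<Otimes>w\<in>F. w [^] card {i\<in>I. u i = w}) \<otimes> (\<Otimes>w\<in>F. if w = u j then u j else \<one>)"
    using assms(3) uj by (intro finprod_multf) auto
  also have "(\<Otimes>w\<in>F. if w = u j then u j else \<one>) = u j"
    using assms(2,3) uj by (subst finprod_singleton_swap) auto
  also have "(\<Otimes>w\<in>F. w [^] card {i\<in>I. u i = w}) = (\<Otimes>i\<in>I. u i)"
    using insert.IH uI by simp
  also have "(\<Otimes>i\<in>I. u i) \<otimes> u j = (\<Otimes>i\<in>insert j I. u i)"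
    using insert.hyps uj uI assms(3)
    by (subst finprod_insert) (auto intro!: m_comm finprod_closed)
  finally show ?case ..
qed

text \<open>Counting how often each value occurs turns an indexed family into weights. In this form
  the result serves as a maximum principle: the values at the neighbours of a vertex are indexed by
  \<open>S\<close> and may repeat.\<close>

lemma (in comm_group) extreme_point:
  assumes "torsion_free G" "finite F" "F \<noteq> {}" "F \<subseteq> carrier G"
  shows "\<exists>v\<in>F. \<forall>(I :: 'c set) u. finite I \<longrightarrow> u \<in> I \<rightarrow> F \<longrightarrow>
           (\<Otimes>i\<in>I. u i) = v [^] card I \<longrightarrow> (\<forall>i\<in>I. u i = v)"
proof -
  obtain v where v: "v \<in> F" and ext: "\<And>a::'a \<Rightarrow> nat.
      (\<Otimes>w\<in>F. w [^] a w) = v [^] (\<Sum>w\<in>F. a w) \<Longrightarrow> (\<forall>w\<in>F. w \<noteq> v \<longrightarrow> a w = 0)"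
    using extreme_point_weights[OF assms] by blast
  have "\<forall>i\<in>I. u i = v"
    if I: "finite I" "u \<in> I \<rightarrow> F" "(\<Otimes>i\<in>I. u i) = v [^] card I" for I :: "'c set" and u
  proof -
    have "(\<Sum>w\<in>F. card {i\<in>I. u i = w}) = card (\<Union>w\<in>F. {i\<in>I. u i = w})"
      using I(1) assms(2) by (subst card_UN_disjoint) auto
    also have "(\<Union>w\<in>F. {i\<in>I. u i = w}) = I"
      using I(2) by auto
    finally have "(\<Otimes>w\<in>F. w [^] card {i\<in>I. u i = w}) = v [^] (\<Sum>w\<in>F. card {i\<in>I. u i = w})"
      using finprod_group_by_value[OF I(1) assms(2,4) I(2)] I(3) by simp
    from ext[OF this] have "\<forall>w\<in>F. w \<noteq> v \<longrightarrow> {i\<in>I. u i = w} = {}"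
      using I(1) by simp
    then show ?thesis
      using I(2) by blast
  qed
  then show ?thesis
    using v by blast
qed

section \<open>Elements central modulo a homomorphism\<close>

lemma (in group) inv_mult_cancel [simp]:
  "a \<in> carrier G \<Longrightarrow> b \<in> carrier G \<Longrightarrow> inv a \<otimes> (a \<otimes> b) = b"
  "a \<in> carrier G \<Longrightarrow> b \<in> carrier G \<Longrightarrow> a \<otimes> (inv a \<otimes> b) = b"
  by (simp_all flip: m_assoc)

lemma (in group) inv_commute:
  assumes "a \<in> carrier G" "b \<in> carrier G" "a \<otimes> b = b \<otimes> a"
  shows "inv a \<otimes> b = b \<otimes> inv a"
proof -
  have "inv a \<otimes> b = inv a \<otimes> (b \<otimes> a) \<otimes> inv a"
    using assms(1,2) by (simp add: m_assoc)
  then show ?thesis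
    using assms(1,2) by (simp add: assms(3)[symmetric])
qed

lemma (in group) mult_commute:
  assumes "a \<in> carrier G" "b \<in> carrier G" "c \<in> carrier G" "a \<otimes> c = c \<otimes> a" "b \<otimes> c = c \<otimes> b"
  shows "a \<otimes> b \<otimes> c = c \<otimes> (a \<otimes> b)"
  using assms by (metis m_assoc)

text \<open>Connectedness of the Cayley graph; symmetry of \<open>S\<close> absorbs the inverses in
  \<open>generate\<close>. The free base point allows a start at a vertex where an extreme value is
  attained.\<close>

lemma (in group) right_translation_induct:
  assumes S: "symmetric_finite_generating_set G S"
    and base: "x\<^sub>0 \<in> carrier G" "P x\<^sub>0"
    and step: "\<And>x s. x \<in> carrier G \<Longrightarrow> s \<in> S \<Longrightarrow> P x \<Longrightarrow> P (x \<otimes> s)"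
    and x: "x \<in> carrier G"
  shows "P x"
proof -
  have sub: "S \<subseteq> carrier G"
    using S by (auto simp: symmetric_finite_generating_set_def)
  have "\<forall>x\<in>carrier G. P x \<longrightarrow> P (x \<otimes> g)" if "g \<in> generate G S" for g
    using that
  proof induction
    case (inv s)
    then show ?case
      using S step by (auto simp: symmetric_finite_generating_set_def)
  next
    case (eng g1 g2)
    then have "g1 \<in> carrier G" "g2 \<in> carrier G"
      using generate_in_carrier[OF sub] by auto
    then show ?case
      using eng.IH by (simp flip: m_assoc)
  qed (use step in auto)
  moreover have "inv x\<^sub>0 \<otimes> x \<in> generate G S"
    using S base x by (simp add: symmetric_finite_generating_set_def)
  ultimately have "P (x\<^sub>0 \<otimes> (inv x\<^sub>0 \<otimes> x))"
    using base by blast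
  then show ?thesis
    using base x by simp
qed

text \<open>For a homomorphism \<open>q\<close> this is the preimage of the centre of the image of
  \<open>q\<close>. Being phrased inside \<open>G\<close> and for any function \<open>q\<close>, it
  can be iterated with \<open>r_coset\<close> before normality is known.\<close>

definition central_mod :: "('a, 'm) monoid_scheme \<Rightarrow> ('a \<Rightarrow> 'c) \<Rightarrow> 'a set" where
  "central_mod G q = {x \<in> carrier G. \<forall>g\<in>carrier G. q (x \<otimes>\<^bsub>G\<^esub> g) = q (g \<otimes>\<^bsub>G\<^esub> x)}"

lemma central_mod_carrier: "x \<in> central_mod G q \<Longrightarrow> x \<in> carrier G"
  by (simp add: central_mod_def)

lemma central_mod_commute:
  "x \<in> central_mod G q \<Longrightarrow> g \<in> carrier G \<Longrightarrow> q (g \<otimes>\<^bsub>G\<^esub> x) = q (x \<otimes>\<^bsub>G\<^esub> g)"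
  by (simp add: central_mod_def)

context group_hom
begin

lemma central_mod_iff:
  "x \<in> central_mod G h \<longleftrightarrow> x \<in> carrier G \<and> (\<forall>g\<in>carrier G. h x \<otimes>\<^bsub>H\<^esub> h g = h g \<otimes>\<^bsub>H\<^esub> h x)"
  by (auto simp: central_mod_def)

lemma hom_conj_central:
  assumes "z \<in> central_mod G h" "g \<in> carrier G"
  shows "h (g \<otimes> z \<otimes> inv g) = h z" "h (inv g \<otimes> z \<otimes> g) = h z"
proof -
  have z: "z \<in> carrier G" "h z \<otimes>\<^bsub>H\<^esub> h g = h g \<otimes>\<^bsub>H\<^esub> h z"
    using assms by (auto simp: central_mod_iff)
  show "h (g \<otimes> z \<otimes> inv g) = h z"
    using z(1) assms(2) by (simp add: z(2)[symmetric] H.m_assoc del: H.Units_r_inv)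
  show "h (inv g \<otimes> z \<otimes> g) = h z"
    using z(1) assms(2) by (simp add: z(2) H.m_assoc)
qed

lemma central_mod_cong:
  assumes "z \<in> central_mod G h" "x \<in> carrier G" "h x = h z"
  shows "x \<in> central_mod G h"
  using assms unfolding central_mod_iff by metis

lemma central_mod_normal: "central_mod G h \<lhd> G"
proof (rule G.normal_invI)
  show "subgroup (central_mod G h) G"
  proof (rule G.subgroupI)
    show "central_mod G h \<subseteq> carrier G"
      by (auto simp: central_mod_iff)
    have "\<one> \<in> central_mod G h"
      by (auto simp: central_mod_def)
    then show "central_mod G h \<noteq> {}"
      by auto
    show "inv a \<in> central_mod G h" if a: "a \<in> central_mod G h" for a
    proof -
      have a': "a \<in> carrier G" "\<And>g. g \<in> carrier G \<Longrightarrow> h a \<otimes>\<^bsub>H\<^esub> h g = h g \<otimes>\<^bsub>H\<^esub> h a"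
        using a by (auto simp: central_mod_iff)
      have "inv\<^bsub>H\<^esub> (h a) \<otimes>\<^bsub>H\<^esub> h g = h g \<otimes>\<^bsub>H\<^esub> inv\<^bsub>H\<^esub> (h a)" if g: "g \<in> carrier G" for g
        by (rule H.inv_commute) (use a'(1) a'(2)[OF g] g in auto)
      then show ?thesis
        using a'(1) by (simp add: central_mod_iff)
    qed
    show "a \<otimes> b \<in> central_mod G h" if "a \<in> central_mod G h" "b \<in> central_mod G h" for a b
    proof -
      have ab: "a \<in> carrier G" "b \<in> carrier G"
        "\<And>g. g \<in> carrier G \<Longrightarrow> h a \<otimes>\<^bsub>H\<^esub> h g = h g \<otimes>\<^bsub>H\<^esub> h a"
        "\<And>g. g \<in> carrier G \<Longrightarrow> h b \<otimes>\<^bsub>H\<^esub> h g = h g \<otimes>\<^bsub>H\<^esub> h b"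
        using that by (auto simp: central_mod_iff)
      have "h a \<otimes>\<^bsub>H\<^esub> h b \<otimes>\<^bsub>H\<^esub> h g = h g \<otimes>\<^bsub>H\<^esub> (h a \<otimes>\<^bsub>H\<^esub> h b)" if g: "g \<in> carrier G" for g
        by (rule H.mult_commute) (use ab(1,2) ab(3,4)[OF g] g in auto)
      then show ?thesis
        using ab(1,2) by (simp add: central_mod_iff)
    qed
  qed
next
  fix x z assume xz: "x \<in> carrier G" "z \<in> central_mod G h"
  then have "z \<in> carrier G"
    by (simp add: central_mod_iff)
  then show "x \<otimes> z \<otimes> inv x \<in> central_mod G h"
    using xz by (intro central_mod_cong[OF xz(2)] hom_conj_central) auto
qed

section \<open>The centre of the image, and harmonic functions with values in it\<close>

abbreviation center_image where
  "center_image \<equiv> H\<lparr>carrier := h ` central_mod G h\<rparr>"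

text \<open>When \<open>h\<close> is the coset map of a term of the relative upper central series,
  this group is the next factor of that series, in which the harmonic function takes its
  values.\<close>

lemma center_image_comm_group: "comm_group center_image"
proof (rule group.group_comm_groupI)
  show "group center_image"
    using central_mod_normal by (intro subgroup.subgroup_is_group subgroup_img_is_subgroup)
      (auto simp: normal_imp_subgroup)
  show "x \<otimes>\<^bsub>center_image\<^esub> y = y \<otimes>\<^bsub>center_image\<^esub> x"
    if "x \<in> carrier center_image" "y \<in> carrier center_image" for x y
    using that unfolding central_mod_def by (auto simp flip: hom_mult)
qed

text \<open>A product of all \<open>h s\<close> is not defined in a non-abelian group, so each
  \<open>s\<close> is compared with a representative \<open>r s\<close> of its coset. As
  \<open>\<sigma>\<close> keeps cosets, the factor at \<open>s\<close> is the quotient of the values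
  of \<open>e\<close> at \<open>\<sigma> s\<close> and at \<open>s\<close>, and these cancel over a
  permutation.\<close>

lemma finprod_permutation_displacement:
  assumes S: "finite S" "S \<subseteq> carrier G" and \<sigma>: "bij_betw \<sigma> S S"
    and disp: "\<And>s. s \<in> S \<Longrightarrow> inv s \<otimes> \<sigma> s \<in> central_mod G h"
  shows "finprod center_image (\<lambda>s. h (inv s \<otimes> \<sigma> s)) S = \<one>\<^bsub>center_image\<^esub>"
proof -
  interpret V: comm_group center_image
    by (rule center_image_comm_group)
  interpret Z: normal "central_mod G h" G
    by (rule central_mod_normal)
  \<comment> \<open>\<open>SOME\<close> picks from the coset as a set, so \<open>r\<close> depends
    on the coset alone; this gives \<open>r_eq\<close>.\<close>
  define r where "r s = (SOME t. t \<in> central_mod G h #> s)" for s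
  have \<sigma>S: "\<sigma> s \<in> S" "s \<in> carrier G" "\<sigma> s \<in> carrier G" if "s \<in> S" for s
    using \<sigma> that S(2) bij_betwE by blast+
  have r: "r s \<in> central_mod G h #> s" if "s \<in> carrier G" for s
    unfolding r_def using G.rcos_self[OF that Z.is_subgroup] by (rule someI)
  have rc: "r s \<in> carrier G" "inv (r s) \<otimes> s \<in> central_mod G h" if s: "s \<in> carrier G" for s
  proof -
    obtain z where z: "z \<in> central_mod G h" "r s = z \<otimes> s"
      using r[OF s] by (auto simp: r_coset_def)
    then have zc: "z \<in> carrier G"
      by auto
    show "r s \<in> carrier G"
      using z zc s by simp
    have "inv (r s) \<otimes> s = inv s \<otimes> inv z \<otimes> s"
      using z zc s by (simp add: G.inv_mult_group)
    then show "inv (r s) \<otimes> s \<in> central_mod G h"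
      using z s by (simp add: Z.inv_op_closed1)
  qed
  have r_eq: "r (\<sigma> s) = r s" if s: "s \<in> S" for s
  proof -
    have "inv s \<otimes> \<sigma> s \<in> central_mod G h"
      using disp s .
    then have "s \<otimes> (inv s \<otimes> \<sigma> s) \<otimes> inv s \<in> central_mod G h"
      using \<sigma>S[OF s] Z.inv_op_closed2 by blast
    then have "\<sigma> s \<otimes> inv s \<in> central_mod G h"
      using \<sigma>S[OF s] by simp
    then have "\<sigma> s \<in> central_mod G h #> s"
      using \<sigma>S[OF s] Z.rcos_module_rev G.is_group by blast
    then have "central_mod G h #> \<sigma> s = central_mod G h #> s"
      using \<sigma>S[OF s] G.repr_independence Z.is_subgroup by metis
    then show ?thesis
      by (simp add: r_def)
  qed
  define e where "e s = h (inv (r s) \<otimes> s)" for s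
  define u where "u = (\<lambda>s. h (inv s \<otimes> \<sigma> s))"
  have e: "e \<in> S \<rightarrow> carrier center_image" and u: "u \<in> S \<rightarrow> carrier center_image"
    using rc S(2) disp by (auto simp: e_def u_def simp del: hom_mult hom_inv intro!: imageI)
  have "e (\<sigma> s) = e s \<otimes>\<^bsub>center_image\<^esub> u s" if s: "s \<in> S" for s
    using s \<sigma>S[OF s] rc(1)[OF \<sigma>S(2)[OF s]] by (simp add: e_def u_def r_eq H.m_assoc)
  then have "finprod center_image (e \<circ> \<sigma>) S = finprod center_image (\<lambda>s. e s \<otimes>\<^bsub>center_image\<^esub> u s) S"
    using e u by (intro V.finprod_cong' Pi_I V.m_closed) (auto dest: Pi_mem)
  also have "\<dots> = finprod center_image e S \<otimes>\<^bsub>center_image\<^esub> finprod center_image u S"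
    using e u by (rule V.finprod_multf)
  also have "finprod center_image (e \<circ> \<sigma>) S = finprod center_image e S"
    using V.finprod_reindex[of e \<sigma> S] \<sigma> e by (simp add: bij_betw_def o_def)
  finally have "finprod center_image u S = \<one>\<^bsub>center_image\<^esub>"
    using V.finprod_closed[OF e] V.finprod_closed[OF u] V.l_cancel_one' by (metis (no_types))
  then show ?thesis
    by (simp only: u_def)
qed

text \<open>The factors at \<open>s\<close> and \<open>inv s\<close> are mutually inverse, because
  conjugation does not alter central values. Reindexing by inversion shows that the square of the
  product is trivial, and there is no 2-torsion. Working with the square also covers
  \<open>s = inv s\<close>.\<close>

lemma finprod_commutators_symmetric:
  assumes tf: "torsion_free center_image"
    and S: "finite S" "S \<subseteq> carrier G" "\<And>s. s \<in> S \<Longrightarrow> inv s \<in> S"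
    and d: "d \<in> carrier G" "\<And>s. s \<in> S \<Longrightarrow> inv d \<otimes> inv s \<otimes> d \<otimes> s \<in> central_mod G h"
  shows "finprod center_image (\<lambda>s. h (inv d \<otimes> inv s \<otimes> d \<otimes> s)) S = \<one>\<^bsub>center_image\<^esub>"
proof -
  interpret V: comm_group center_image
    by (rule center_image_comm_group)
  define k where "k = (\<lambda>s. h (inv d \<otimes> inv s \<otimes> d \<otimes> s))"
  have k: "k \<in> S \<rightarrow> carrier center_image"
    using d by (auto simp: k_def)
  have inv_im: "(\<lambda>s. inv s) ` S = S"
  proof
    show "S \<subseteq> (\<lambda>s. inv s) ` S"
    proof
      fix s assume "s \<in> S"
      then have "s = inv (inv s)" "inv s \<in> S"
        using S by auto
      then show "s \<in> (\<lambda>s. inv s) ` S"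
        by (rule image_eqI)
    qed
  qed (use S in auto)
  have "inj_on (\<lambda>s. inv s) S"
    using S(2) by (meson G.inv_inj inj_on_subset)
  then have re: "finprod center_image (\<lambda>s. k (inv s)) S = finprod center_image k S"
    using V.finprod_reindex[of k "\<lambda>s. inv s" S] k inv_im by simp
  have kk: "k s \<otimes>\<^bsub>center_image\<^esub> k (inv s) = \<one>\<^bsub>center_image\<^esub>" if s: "s \<in> S" for s
  proof -
    have sc: "s \<in> carrier G"
      using s S by auto
    have *: "inv d \<otimes> s \<otimes> d \<otimes> inv s \<in> central_mod G h"
      using d(2)[OF S(3)[OF s]] sc by simp
    have "k (inv s) = h (inv s \<otimes> (inv d \<otimes> s \<otimes> d \<otimes> inv s) \<otimes> s)"
      using hom_conj_central(2)[OF * sc] sc by (simp add: k_def)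
    then have "k s \<otimes>\<^bsub>H\<^esub> k (inv s) = h (inv d \<otimes> inv s \<otimes> d \<otimes> s \<otimes> (inv s \<otimes> (inv d \<otimes> s \<otimes> d \<otimes> inv s) \<otimes> s))"
      using sc d by (simp add: k_def)
    also have "inv d \<otimes> inv s \<otimes> d \<otimes> s \<otimes> (inv s \<otimes> (inv d \<otimes> s \<otimes> d \<otimes> inv s) \<otimes> s) = \<one>"
      using sc d by (simp add: G.m_assoc)
    finally show ?thesis
      by simp
  qed
  define P where "P = finprod center_image k S"
  have Pc: "P \<in> carrier center_image"
    unfolding P_def using k by (rule V.finprod_closed)
  have ki: "(\<lambda>s. k (inv s)) \<in> S \<rightarrow> carrier center_image"
    using k S(3) by auto
  have "P \<otimes>\<^bsub>center_image\<^esub> P = finprod center_image k S \<otimes>\<^bsub>center_image\<^esub> finprod center_image (\<lambda>s. k (inv s)) S"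
    by (simp only: P_def re)
  also have "\<dots> = finprod center_image (\<lambda>s. k s \<otimes>\<^bsub>center_image\<^esub> k (inv s)) S"
    using k ki by (rule V.finprod_multf[symmetric])
  also have "\<dots> = \<one>\<^bsub>center_image\<^esub>"
    by (rule V.finprod_one_eqI) (rule kk)
  finally have "P [^]\<^bsub>center_image\<^esub> (2::nat) = \<one>\<^bsub>center_image\<^esub>"
    using V.l_one[OF Pc] by (simp add: numeral_2_eq_2)
  then have "P = \<one>\<^bsub>center_image\<^esub>"
    using tf Pc unfolding torsion_free_def by (meson zero_less_numeral)
  then show ?thesis
    by (simp only: P_def k_def)
qed

text \<open>One step of the descent. Passing from \<open>x\<close> to its neighbours brings in
  commutators \<open>k s\<close> and permutation terms \<open>t x s\<close>, whose products over
  \<open>S\<close> are trivial; hence \<open>h (e x)\<close> is harmonic in \<open>x\<close>. Its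
  range is finite, so the maximum principle applies at an extreme point.\<close>

lemma displacement_constant_mod:
  assumes tf: "torsion_free center_image"
    and S: "symmetric_finite_generating_set G S"
    and f: "f \<in> carrier G \<rightarrow> carrier G"
    and perm: "\<And>x. x \<in> carrier G \<Longrightarrow> bij_betw (\<lambda>s. inv (f x) \<otimes> f (x \<otimes> s)) S S"
    and d: "d \<in> carrier G" "\<And>g. g \<in> carrier G \<Longrightarrow> inv d \<otimes> inv g \<otimes> d \<otimes> g \<in> central_mod G h"
    and disp: "\<And>x. x \<in> carrier G \<Longrightarrow> inv d \<otimes> (inv x \<otimes> f x) \<in> central_mod G h"
    and fin: "finite ((\<lambda>x. h (inv x \<otimes> f x)) ` carrier G)"
  obtains d' where "d' \<in> carrier G" "\<And>x. x \<in> carrier G \<Longrightarrow> h (f x) = h (x \<otimes> d')"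
proof -
  interpret V: comm_group center_image
    by (rule center_image_comm_group)
  interpret Z: normal "central_mod G h" G
    by (rule central_mod_normal)
  have S': "finite S" "S \<subseteq> carrier G" "\<And>s. s \<in> S \<Longrightarrow> inv s \<in> S"
    using S by (auto simp: symmetric_finite_generating_set_def)
  have fc: "f x \<in> carrier G" if "x \<in> carrier G" for x
    using f that by auto
  define e where "e x = inv d \<otimes> (inv x \<otimes> f x)" for x
  define k where "k g = inv d \<otimes> inv g \<otimes> d \<otimes> g" for g
  define t where "t x s = inv s \<otimes> (inv (f x) \<otimes> f (x \<otimes> s))" for x s
  have e: "e x \<in> central_mod G h" "e x \<in> carrier G" if "x \<in> carrier G" for x
    using disp[OF that] by (auto simp: e_def)
  have k: "k g \<in> central_mod G h" "k g \<in> carrier G" if "g \<in> carrier G" for g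
    using d(2)[OF that] by (auto simp: k_def)
  \<comment> \<open>The right side telescopes. The factor \<open>k s\<close> depends on
    \<open>s\<close> only, while \<open>t x s\<close> is the displacement of the permutation of
    \<open>S\<close> induced by \<open>f\<close> at \<open>x\<close>.\<close>
  have e_step: "e (x \<otimes> s) = k s \<otimes> (inv s \<otimes> e x \<otimes> s \<otimes> t x s)"
    if x: "x \<in> carrier G" and s: "s \<in> carrier G" for x s
    using d(1) x s fc[OF x] fc[OF G.m_closed[OF x s]]
    by (simp add: e_def k_def t_def G.m_assoc G.inv_mult_group)
  \<comment> \<open>Solving \<open>e_step\<close> for \<open>t x s\<close> exhibits it as a product
    of elements central modulo \<open>h\<close>.\<close>
  have t: "t x s \<in> central_mod G h" if x: "x \<in> carrier G" and s: "s \<in> carrier G" for x s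
  proof -
    have tc: "t x s \<in> carrier G"
      using x s fc by (simp add: t_def)
    have "t x s = inv (inv s \<otimes> e x \<otimes> s) \<otimes> (inv (k s) \<otimes> e (x \<otimes> s))"
      using e(2)[OF x] k(2)[OF s] s tc by (simp add: e_step[OF x s] G.m_assoc G.inv_mult_group)
    moreover have "inv s \<otimes> e x \<otimes> s \<in> central_mod G h"
      using e(1)[OF x] s by (simp add: Z.inv_op_closed1)
    ultimately show ?thesis
      using e(1)[of "x \<otimes> s"] k(1)[OF s] x s by simp
  qed
  have he_step: "h (e (x \<otimes> s)) = h (k s) \<otimes>\<^bsub>center_image\<^esub> (h (e x) \<otimes>\<^bsub>center_image\<^esub> h (t x s))"
    if x: "x \<in> carrier G" and s: "s \<in> carrier G" for x s
  proof -
    have "t x s \<in> carrier G"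
      using t[OF x s] by auto
    then have "h (e (x \<otimes> s)) = h (k s) \<otimes>\<^bsub>H\<^esub> (h (inv s \<otimes> e x \<otimes> s) \<otimes>\<^bsub>H\<^esub> h (t x s))"
      using e(2)[OF x] k(2)[OF s] s by (simp add: e_step[OF x s])
    also have "h (inv s \<otimes> e x \<otimes> s) = h (e x)"
      by (rule hom_conj_central(2)[OF e(1)[OF x] s])
    finally show ?thesis
      by simp
  qed
  have harmonic: "finprod center_image (\<lambda>s. h (e (x \<otimes> s))) S = h (e x) [^]\<^bsub>center_image\<^esub> card S"
    if x: "x \<in> carrier G" for x
  proof -
    have cl: "(\<lambda>s. h (k s)) \<in> S \<rightarrow> carrier center_image" "(\<lambda>s. h (t x s)) \<in> S \<rightarrow> carrier center_image"
      "(\<lambda>s. h (e x)) \<in> S \<rightarrow> carrier center_image"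
      using k(1) t[OF x] e(1)[OF x] S'(2) by auto
    have "finprod center_image (\<lambda>s. h (e (x \<otimes> s))) S
        = finprod center_image (\<lambda>s. h (k s) \<otimes>\<^bsub>center_image\<^esub> (h (e x) \<otimes>\<^bsub>center_image\<^esub> h (t x s))) S"
    proof (rule V.finprod_cong')
      show "(\<lambda>s. h (k s) \<otimes>\<^bsub>center_image\<^esub> (h (e x) \<otimes>\<^bsub>center_image\<^esub> h (t x s))) \<in> S \<rightarrow> carrier center_image"
        using cl by (intro Pi_I V.m_closed) (auto dest: Pi_mem)
    qed (use he_step[OF x] S'(2) in auto)
    also have "\<dots> = finprod center_image (\<lambda>s. h (k s)) S \<otimes>\<^bsub>center_image\<^esub>
        finprod center_image (\<lambda>s. h (e x) \<otimes>\<^bsub>center_image\<^esub> h (t x s)) S"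
      using cl by (intro V.finprod_multf Pi_I V.m_closed) (auto dest: Pi_mem)
    also have "finprod center_image (\<lambda>s. h (e x) \<otimes>\<^bsub>center_image\<^esub> h (t x s)) S
        = finprod center_image (\<lambda>s. h (e x)) S \<otimes>\<^bsub>center_image\<^esub> finprod center_image (\<lambda>s. h (t x s)) S"
      by (rule V.finprod_multf[OF cl(3,2)])
    also have "finprod center_image (\<lambda>s. h (t x s)) S = \<one>\<^bsub>center_image\<^esub>"
      using finprod_permutation_displacement[OF S'(1,2) perm[OF x]] t[OF x] S'(2)
      unfolding t_def by blast
    also have "finprod center_image (\<lambda>s. h (k s)) S = \<one>\<^bsub>center_image\<^esub>"
      using finprod_commutators_symmetric[OF tf S' d(1)] d(2) S'(2)
      unfolding k_def by blast
    also have "finprod center_image (\<lambda>s. h (e x)) S = h (e x) [^]\<^bsub>center_image\<^esub> card S"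
      using e(1)[OF x] by (intro V.finprod_const) auto
    finally show ?thesis
      using V.nat_pow_closed[of "h (e x)" "card S"] V.l_one V.r_one e(1)[OF x] by simp
  qed
  define F where "F = (\<lambda>x. h (e x)) ` carrier G"
  \<comment> \<open>Left translation by \<open>h (inv d)\<close> reduces the finiteness of
    \<open>F\<close> to \<open>fin\<close>.\<close>
  have "F \<subseteq> (\<lambda>y. h (inv d) \<otimes>\<^bsub>H\<^esub> y) ` ((\<lambda>x. h (inv x \<otimes> f x)) ` carrier G)"
  proof
    fix y assume "y \<in> F"
    then obtain x where x: "x \<in> carrier G" "y = h (e x)"
      by (auto simp: F_def)
    then have "y = h (inv d) \<otimes>\<^bsub>H\<^esub> h (inv x \<otimes> f x)"
      using d(1) fc by (simp add: e_def)
    then show "y \<in> (\<lambda>y. h (inv d) \<otimes>\<^bsub>H\<^esub> y) ` ((\<lambda>x. h (inv x \<otimes> f x)) ` carrier G)"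
      using x(1) by blast
  qed
  then have F: "finite F" "F \<noteq> {}" "F \<subseteq> carrier center_image"
    using fin finite_surj e(1) by (auto simp: F_def intro: finite_subset)
  obtain v where v: "v \<in> F" and ext: "\<And>I u. finite I \<Longrightarrow> u \<in> I \<rightarrow> F \<Longrightarrow>
      finprod center_image u I = v [^]\<^bsub>center_image\<^esub> card I \<Longrightarrow> \<forall>i\<in>(I :: 'a set). u i = v"
    using V.extreme_point[OF tf F] by blast
  obtain x\<^sub>0 where x\<^sub>0: "x\<^sub>0 \<in> carrier G" "h (e x\<^sub>0) = v"
    using v by (auto simp: F_def)
  \<comment> \<open>Where the extreme value \<open>v\<close> is attained, harmonicity and
    \<open>ext\<close> force it on all neighbours; connectedness does the rest.\<close>
  have const: "h (e x) = v" if "x \<in> carrier G" for x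
    using S x\<^sub>0 _ that
  proof (rule G.right_translation_induct)
    fix x s assume x: "x \<in> carrier G" "s \<in> S" "h (e x) = v"
    have "\<forall>s\<in>S. h (e (x \<otimes> s)) = v"
      using harmonic[OF x(1)] x(1,3) S'(1,2) by (intro ext) (auto simp: F_def)
    then show "h (e (x \<otimes> s)) = v"
      using x(2) by blast
  qed
  \<comment> \<open>The witness for \<open>d'\<close> is \<open>f \<one>\<close>, whose image under
    \<open>h\<close> is \<open>h d\<close> times the constant \<open>v\<close>.\<close>
  have "h (f x) = h (x \<otimes> f \<one>)" if x: "x \<in> carrier G" for x
  proof -
    have "f x = x \<otimes> (d \<otimes> e x)"
      using x d(1) fc[OF x] by (simp add: e_def)
    then have "h (f x) = h x \<otimes>\<^bsub>H\<^esub> (h d \<otimes>\<^bsub>H\<^esub> v)"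
      using x d(1) e(2)[OF x] const[OF x] by simp
    moreover have "f \<one> = d \<otimes> e \<one>"
      using d(1) fc by (simp add: e_def)
    then have "h (x \<otimes> f \<one>) = h x \<otimes>\<^bsub>H\<^esub> (h d \<otimes>\<^bsub>H\<^esub> v)"
      using x d(1) e(2)[of \<one>] const[of \<one>] by simp
    ultimately show ?thesis
      by simp
  qed
  then show thesis
    by (rule that[OF fc[OF G.one_closed]])
qed

text \<open>Under \<open>h\<close>, conjugation by \<open>d\<close> acts on the generators as the
  self-map \<open>\<sigma>\<close> of the finite set \<open>S\<close>. Two iterates of
  \<open>\<sigma>\<close> agree, so a positive power of \<open>d\<close> commutes under
  \<open>h\<close> with all generators, hence with everything.\<close>

lemma power_of_displacement_central:
  assumes S: "symmetric_finite_generating_set G S"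
    and f: "f \<in> carrier G \<rightarrow> carrier G"
    and step: "\<And>s. s \<in> S \<Longrightarrow> inv (f \<one>) \<otimes> f s \<in> S"
    and d: "d \<in> carrier G" "\<And>x. x \<in> carrier G \<Longrightarrow> h (f x) = h (x \<otimes> d)"
  obtains n :: nat where "n > 0" "d [^] n \<in> central_mod G h"
proof -
  have S': "finite S" "S \<subseteq> carrier G"
    using S by (auto simp: symmetric_finite_generating_set_def)
  define \<sigma> where "\<sigma> s = inv (f \<one>) \<otimes> f s" for s
  have \<sigma>S: "(\<sigma> ^^ n) s \<in> S" if "s \<in> S" for n s
    using that step by (induction n) (auto simp: \<sigma>_def)
  have h\<sigma>: "h (\<sigma> s) = inv\<^bsub>H\<^esub> h d \<otimes>\<^bsub>H\<^esub> h s \<otimes>\<^bsub>H\<^esub> h d" if s: "s \<in> S" for s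
  proof -
    have "f \<one> \<in> carrier G" "f s \<in> carrier G" "s \<in> carrier G"
      using f s S' by auto
    then show ?thesis
      using d(1) d(2)[of \<one>] d(2)[of s] by (simp add: \<sigma>_def H.m_assoc)
  qed
  have h\<sigma>n: "h ((\<sigma> ^^ n) s) = inv\<^bsub>H\<^esub> h (d [^] n) \<otimes>\<^bsub>H\<^esub> h s \<otimes>\<^bsub>H\<^esub> h (d [^] n)" if s: "s \<in> S" for s n
  proof (induction n)
    case 0
    then show ?case
      using s S' by auto
  next
    case (Suc n)
    have "s \<in> carrier G"
      using s S' by auto
    then show ?case
      using Suc d(1) h\<sigma>[OF \<sigma>S[OF s, of n]] by (simp add: H.m_assoc H.inv_mult_group)
  qed
  \<comment> \<open>Restriction to \<open>S\<close> places all iterates in the finite set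
    \<open>S \<rightarrow>\<^sub>E S\<close>, so two of them coincide.\<close>
  have "\<not> inj (\<lambda>n::nat. restrict (\<sigma> ^^ n) S)"
  proof
    assume "inj (\<lambda>n::nat. restrict (\<sigma> ^^ n) S)"
    moreover have "range (\<lambda>n::nat. restrict (\<sigma> ^^ n) S) \<subseteq> S \<rightarrow>\<^sub>E S"
      using \<sigma>S by auto
    ultimately show False
      using S'(1) by (meson finite_PiE finite_subset infinite_UNIV_nat finite_imageD)
  qed
  then obtain m n :: nat where "m \<noteq> n" "restrict (\<sigma> ^^ m) S = restrict (\<sigma> ^^ n) S"
    by (auto simp: inj_def)
  then obtain m n :: nat where mn: "m < n" "\<And>s. s \<in> S \<Longrightarrow> (\<sigma> ^^ m) s = (\<sigma> ^^ n) s"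
    by (metis linorder_neqE_nat restrict_apply')
  define c where "c = d [^] (n - m)"
  have c: "c \<in> carrier G" "d [^] n = c \<otimes> d [^] m"
    using d(1) mn(1) by (auto simp: c_def G.nat_pow_mult)
  have comm: "h c \<otimes>\<^bsub>H\<^esub> h s = h s \<otimes>\<^bsub>H\<^esub> h c" if s: "s \<in> S" for s
  proof -
    have sc: "s \<in> carrier G"
      using s S' by auto
    \<comment> \<open>The two agreeing iterates are conjugations by \<open>a\<close> and by
      \<open>h c\<close> times \<open>a\<close>; cancelling \<open>a\<close> leaves conjugation by
      \<open>h c\<close>, which therefore fixes \<open>h s\<close>.\<close>
    define a where "a = h (d [^] m)"
    have a: "a \<in> carrier H"
      using d(1) by (simp add: a_def)
    have "inv\<^bsub>H\<^esub> a \<otimes>\<^bsub>H\<^esub> h s \<otimes>\<^bsub>H\<^esub> a = inv\<^bsub>H\<^esub> (h c \<otimes>\<^bsub>H\<^esub> a) \<otimes>\<^bsub>H\<^esub> h s \<otimes>\<^bsub>H\<^esub> (h c \<otimes>\<^bsub>H\<^esub> a)"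
      using h\<sigma>n[OF s, of m] h\<sigma>n[OF s, of n] mn(2)[OF s] c d(1) by (simp add: a_def)
    then have "inv\<^bsub>H\<^esub> a \<otimes>\<^bsub>H\<^esub> (h s \<otimes>\<^bsub>H\<^esub> a) = inv\<^bsub>H\<^esub> a \<otimes>\<^bsub>H\<^esub> (inv\<^bsub>H\<^esub> h c \<otimes>\<^bsub>H\<^esub> h s \<otimes>\<^bsub>H\<^esub> h c \<otimes>\<^bsub>H\<^esub> a)"
      using a sc c(1) by (simp add: H.m_assoc H.inv_mult_group)
    then have "h s = inv\<^bsub>H\<^esub> h c \<otimes>\<^bsub>H\<^esub> h s \<otimes>\<^bsub>H\<^esub> h c"
      using a sc c(1) by simp
    then have "h c \<otimes>\<^bsub>H\<^esub> h s = h c \<otimes>\<^bsub>H\<^esub> (inv\<^bsub>H\<^esub> h c \<otimes>\<^bsub>H\<^esub> h s \<otimes>\<^bsub>H\<^esub> h c)"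
      by simp
    then show ?thesis
      using sc c(1) by (simp add: H.m_assoc)
  qed
  have "h c \<otimes>\<^bsub>H\<^esub> h x = h x \<otimes>\<^bsub>H\<^esub> h c" if "x \<in> carrier G" for x
    using S G.one_closed _ _ that
  proof (rule G.right_translation_induct)
    fix x s assume x: "x \<in> carrier G" "s \<in> S" "h c \<otimes>\<^bsub>H\<^esub> h x = h x \<otimes>\<^bsub>H\<^esub> h c"
    then have "s \<in> carrier G"
      using S' by auto
    then show "h c \<otimes>\<^bsub>H\<^esub> h (x \<otimes> s) = h (x \<otimes> s) \<otimes>\<^bsub>H\<^esub> h c"
      using H.mult_commute[of "h x" "h s" "h c"] x comm[OF x(2)] c(1) by simp
  qed (use c in simp)
  then have "c \<in> central_mod G h"
    using c(1) unfolding central_mod_iff by blast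
  then show thesis
    using that[of "n - m"] mn(1) by (simp add: c_def)
qed

end

section \<open>The upper central series relative to a finite normal subgroup\<close>

lemma (in group) conj_nat_pow:
  assumes "g \<in> carrier G" "x \<in> carrier G"
  shows "(g \<otimes> x \<otimes> inv g) [^] (n::nat) = g \<otimes> x [^] n \<otimes> inv g"
  using assms by (induction n) (simp_all add: m_assoc)

text \<open>By normality, right cosets obey the left-coset criterion, which is the form in which
  displacements \<open>inv x \<otimes> f x\<close> occur. Right cosets are kept because
  \<open>Mod\<close> consists of them.\<close>

lemma (in normal) rcos_eq_iff:
  assumes x: "x \<in> carrier G" and y: "y \<in> carrier G"
  shows "H #> x = H #> y \<longleftrightarrow> inv x \<otimes> y \<in> H"
proof -
  have "H #> x = H #> y \<longleftrightarrow> y \<in> H #> x"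
    using x y by (metis rcos_self repr_independence is_subgroup)
  also have "\<dots> \<longleftrightarrow> y \<otimes> inv x \<in> H"
    using x y rcos_module is_group by blast
  also have "\<dots> \<longleftrightarrow> inv x \<otimes> y \<in> H"
  proof
    assume "y \<otimes> inv x \<in> H"
    then have "inv x \<otimes> (y \<otimes> inv x) \<otimes> x \<in> H"
      using x inv_op_closed1 by blast
    then show "inv x \<otimes> y \<in> H"
      using x y by (simp add: m_assoc)
  next
    assume "inv x \<otimes> y \<in> H"
    then have "x \<otimes> (inv x \<otimes> y) \<otimes> inv x \<in> H"
      using x inv_op_closed2 by blast
    then show "y \<otimes> inv x \<in> H"
      using x y by simp
  qed
  finally show ?thesis .
qed

lemma (in normal) rcos_eq_one_iff:
  assumes "x \<in> carrier G"
  shows "H #> x = H \<longleftrightarrow> x \<in> H"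
  using rcos_eq_iff[OF one_closed assms] assms coset_mult_one[OF subset] by auto

lemma (in normal) quotient_hom: "group_hom G (G Mod H) (r_coset G H)"
  using r_coset_hom_Mod factorgroup_is_group
  by (simp add: group_hom_def group_hom_axioms_def)

context group_hom
begin

lemma center_image_torsion_free:
  assumes "\<And>z n::nat. z \<in> central_mod G h \<Longrightarrow> n > 0 \<Longrightarrow> h (z [^] n) = \<one>\<^bsub>H\<^esub> \<Longrightarrow> h z = \<one>\<^bsub>H\<^esub>"
  shows "torsion_free center_image"
  unfolding torsion_free_def
proof (intro ballI allI impI)
  fix v and n :: nat
  assume v: "v \<in> carrier center_image" "n > 0" "v [^]\<^bsub>center_image\<^esub> n = \<one>\<^bsub>center_image\<^esub>"
  obtain z where z: "z \<in> central_mod G h" "v = h z"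
    using v(1) by auto
  then have "z \<in> carrier G"
    by (simp add: central_mod_def)
  then have "h (z [^] n) = \<one>\<^bsub>H\<^esub>"
    using v(3) z(2) by (simp add: hom_nat_pow flip: H.nat_pow_consistent)
  then show "v = \<one>\<^bsub>center_image\<^esub>"
    using assms[OF z(1) v(2)] z(2) by simp
qed

text \<open>For \<open>x\<close> central one level up,
  \<open>g \<otimes> x \<otimes> inv g = x \<otimes> c\<close> with \<open>c\<close> central modulo
  \<open>h\<close>. Taking \<open>n\<close>-th powers, where \<open>x [^] n\<close> is unchanged by
  conjugation under \<open>h\<close>, shows that \<open>c [^] n\<close> is trivial under
  \<open>h\<close>; then so is \<open>c\<close>, by \<open>tf\<close>.\<close>

lemma central_mod_torsion_free_step:
  fixes n :: nat
  assumes tf: "\<And>z n::nat. z \<in> central_mod G h \<Longrightarrow> n > 0 \<Longrightarrow> h (z [^] n) = \<one>\<^bsub>H\<^esub> \<Longrightarrow> h z = \<one>\<^bsub>H\<^esub>"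
    and x: "x \<in> central_mod G (r_coset G (central_mod G h))"
    and n: "n > 0" "x [^] n \<in> central_mod G h"
  shows "x \<in> central_mod G h"
proof -
  interpret Z: normal "central_mod G h" G
    by (rule central_mod_normal)
  interpret Q: group_hom G "G Mod central_mod G h" "r_coset G (central_mod G h)"
    by (rule Z.quotient_hom)
  have xc: "x \<in> carrier G"
    using x by (rule central_mod_carrier)
  have "h (x \<otimes> g) = h (g \<otimes> x)" if g: "g \<in> carrier G" for g
  proof -
    define c where "c = inv x \<otimes> (g \<otimes> x \<otimes> inv g)"
    have c: "c \<in> central_mod G h"
      unfolding c_def using Q.hom_conj_central(1)[OF x g] Z.rcos_eq_iff[OF xc, of "g \<otimes> x \<otimes> inv g"] xc g
      by simp
    then have cc: "c \<in> carrier G"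
      by auto
    have gx: "g \<otimes> x \<otimes> inv g = x \<otimes> c"
      using xc g by (simp add: c_def)
    have comm: "h x \<otimes>\<^bsub>H\<^esub> h c = h c \<otimes>\<^bsub>H\<^esub> h x"
      using c xc unfolding central_mod_iff by (metis (no_types))
    have "h x [^]\<^bsub>H\<^esub> n \<otimes>\<^bsub>H\<^esub> h c [^]\<^bsub>H\<^esub> n = (h x \<otimes>\<^bsub>H\<^esub> h c) [^]\<^bsub>H\<^esub> n"
      using H.pow_mult_distrib[OF comm] xc cc by simp
    also have "\<dots> = h ((g \<otimes> x \<otimes> inv g) [^] n)"
      unfolding gx using xc cc by (simp add: hom_nat_pow)
    also have "\<dots> = h (x [^] n)"
      using hom_conj_central(1)[OF n(2) g] G.conj_nat_pow[OF g xc] by simp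
    finally have "h (c [^] n) = \<one>\<^bsub>H\<^esub>"
      using xc cc by (simp add: hom_nat_pow)
    then have "h c = \<one>\<^bsub>H\<^esub>"
      using tf[OF c n(1)] by blast
    then have "h (g \<otimes> x \<otimes> inv g) = h x"
      unfolding gx using xc cc by simp
    then have "h (g \<otimes> x \<otimes> inv g) \<otimes>\<^bsub>H\<^esub> h g = h x \<otimes>\<^bsub>H\<^esub> h g"
      by simp
    then show ?thesis
      using xc g by (simp add: H.m_assoc)
  qed
  then show ?thesis
    using xc unfolding central_mod_def by blast
qed

end

text \<open>The \<open>i\<close>-th term is the preimage in \<open>G\<close> of the \<open>i\<close>-th centre of \<open>G/N\<close>: staying inside \<open>G\<close> avoids
  iterated quotients, whose types would grow with \<open>i\<close>.\<close>

fun upper_central :: "('a, 'm) monoid_scheme \<Rightarrow> 'a set \<Rightarrow> nat \<Rightarrow> 'a set" where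
  "upper_central G N 0 = N"
| "upper_central G N (Suc i) = central_mod G (r_coset G (upper_central G N i))"

locale finite_by_torsion_free_nilpotent = group G for G (structure) +
  fixes N
  assumes N_normal: "N \<lhd> G" and N_finite: "finite N"
    and quotient_torsion_free: "torsion_free (G Mod N)" and quotient_nilpotent: "nilpotent (G Mod N)"
begin

abbreviation "Z \<equiv> upper_central G N"

lemma Z_normal: "Z i \<lhd> G"
  by (induction i) (auto simp: N_normal intro: normal.quotient_hom group_hom.central_mod_normal)

lemma Z_hom: "group_hom G (G Mod Z i) (r_coset G (Z i))"
  by (intro normal.quotient_hom Z_normal)

lemma Z_sub: "Z i \<subseteq> carrier G"
  using Z_normal[of i] normal_imp_subgroup subgroup.subset by blast

lemmas Z_eq_iff = normal.rcos_eq_iff[OF Z_normal]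

lemma Z_mono: "i \<le> j \<Longrightarrow> Z i \<subseteq> Z j"
proof (induction rule: dec_induct)
  case (step n)
  interpret group_hom G "G Mod Z n" "r_coset G (Z n)"
    by (rule Z_hom)
  have "x \<in> Z (Suc n)" if x: "x \<in> Z n" for x
  proof -
    have xc: "x \<in> carrier G"
      using x Z_sub by auto
    have "Z n #> x = \<one>\<^bsub>G Mod Z n\<^esub>"
      using normal.rcos_eq_one_iff[OF Z_normal xc] x by simp
    then have "Z n #> (x \<otimes> g) = Z n #> (g \<otimes> x)" if "g \<in> carrier G" for g
      using that xc hom_mult[of x g] hom_mult[of g x] H.l_one H.r_one hom_closed by metis
    then show ?thesis
      using xc by (simp add: central_mod_def)
  qed
  then show ?case
    using step by blast
qed simp

lemma Z_cong_mono:
  assumes "i \<le> j" "x \<in> carrier G" "y \<in> carrier G" "Z i #> x = Z i #> y"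
  shows "Z j #> x = Z j #> y"
  using assms Z_mono[OF assms(1)] by (auto simp: Z_eq_iff)

text \<open>Induction on \<open>i\<close>: case 0 is torsion-freeness of \<open>G Mod N\<close>, and
  then each torsion-free factor passes the property on to the next by
  \<open>central_mod_torsion_free_step\<close>.\<close>

lemma Z_isolated_step:
  fixes n :: nat
  assumes "z \<in> Z (Suc i)" "n > 0" "z [^] n \<in> Z i"
  shows "z \<in> Z i"
  using assms
proof (induction i arbitrary: z n)
  case 0
  interpret N: normal N G
    by (rule N_normal)
  have z: "z \<in> carrier G"
    using 0 Z_sub by blast
  then have "(N #> z) [^]\<^bsub>G Mod N\<^esub> n = \<one>\<^bsub>G Mod N\<^esub>"
    using 0 N.rcos_eq_one_iff[of "z [^] n"] by (simp add: N.FactGroup_pow)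
  then have "N #> z = \<one>\<^bsub>G Mod N\<^esub>"
    using quotient_torsion_free 0(2) z unfolding torsion_free_def by (auto simp: carrier_FactGroup)
  then show ?case
    using N.rcos_eq_one_iff[OF z] by simp
next
  case (Suc i)
  interpret group_hom G "G Mod Z i" "r_coset G (Z i)"
    by (rule Z_hom)
  have "Z i #> z = \<one>\<^bsub>G Mod Z i\<^esub>"
    if "z \<in> central_mod G (r_coset G (Z i))" "n > 0" "Z i #> (z [^] n) = \<one>\<^bsub>G Mod Z i\<^esub>" for z and n :: nat
  proof -
    have "z \<in> carrier G"
      using that(1) by (rule central_mod_carrier)
    then show ?thesis
      using Suc.IH[of z n] that normal.rcos_eq_one_iff[OF Z_normal, of _ i] by simp
  qed
  then show ?case
    using central_mod_torsion_free_step[of z n] Suc.prems by simp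
qed

text \<open>Comparison of the two series: by induction on \<open>k\<close>, the preimage of the
  lower central term \<open>n - k\<close> of \<open>G Mod N\<close> lies in \<open>Z k\<close>, and
  for \<open>k = n\<close> that preimage is the whole group. The bound \<open>c \<ge> j\<close> lets
  a descent from \<open>c\<close> reach any given level \<open>j\<close>.\<close>

lemma Z_top: "\<exists>c\<ge>j. Z c = carrier G"
proof -
  interpret N: normal N G
    by (rule N_normal)
  interpret Q: group_hom G "G Mod N" "r_coset G N"
    by (rule N.quotient_hom)
  obtain n where n: "lower_central (G Mod N) n = {\<one>\<^bsub>G Mod N\<^esub>}"
    using quotient_nilpotent unfolding nilpotent_def by blast
  have "\<forall>x\<in>carrier G. N #> x \<in> lower_central (G Mod N) (n - k) \<longrightarrow> x \<in> Z k" if "k \<le> n" for k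
    using that
  proof (induction k)
    case 0
    then show ?case
      using n N.rcos_eq_one_iff by simp
  next
    case (Suc k)
    show ?case
    proof (intro ballI impI)
      fix x assume x: "x \<in> carrier G" "N #> x \<in> lower_central (G Mod N) (n - Suc k)"
      have "Z k #> (x \<otimes> g) = Z k #> (g \<otimes> x)" if g: "g \<in> carrier G" for g
      proof -
        have "n - k = Suc (n - Suc k)"
          using Suc.prems by simp
        \<comment> \<open>The commutator is formed with \<open>inv g\<close> so that conjugation by
          \<open>x\<close> turns it into
          \<open>inv (x \<otimes> g) \<otimes> (g \<otimes> x)\<close>, as \<open>Z_eq_iff\<close>
          requires.\<close>
        moreover have "N #> (x \<otimes> inv g \<otimes> inv x \<otimes> g) \<in> lower_central (G Mod N) (Suc (n - Suc k))"
        proof -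
          have eq: "N #> (x \<otimes> inv g \<otimes> inv x \<otimes> g) =
              (N #> x) \<otimes>\<^bsub>G Mod N\<^esub> (N #> inv g) \<otimes>\<^bsub>G Mod N\<^esub> inv\<^bsub>G Mod N\<^esub> (N #> x) \<otimes>\<^bsub>G Mod N\<^esub> inv\<^bsub>G Mod N\<^esub> (N #> inv g)"
            using x(1) g by (simp del: mult_FactGroup)
          show ?thesis
            unfolding lower_central.simps eq
            by (intro generate.incl UN_I[of "N #> x"] UN_I[of "N #> inv g"] singletonI)
              (use x g Q.hom_closed in auto)
        qed
        ultimately have "x \<otimes> inv g \<otimes> inv x \<otimes> g \<in> Z k"
          using Suc x(1) g by simp
        then have "inv x \<otimes> (x \<otimes> inv g \<otimes> inv x \<otimes> g) \<otimes> x \<in> Z k"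
          using normal.inv_op_closed1[OF Z_normal] x(1) by blast
        then have "inv (x \<otimes> g) \<otimes> (g \<otimes> x) \<in> Z k"
          using x(1) g by (simp add: m_assoc inv_mult_group)
        then show ?thesis
          using x(1) g by (simp add: Z_eq_iff)
      qed
      then show "x \<in> Z (Suc k)"
        using x(1) by (simp add: central_mod_def)
    qed
  qed
  from this[of n] have "carrier G \<subseteq> Z n"
    using Q.hom_closed by auto
  then have "Z (max j n) = carrier G"
    using Z_mono[of n "max j n"] Z_sub by fastforce
  then show ?thesis
    by (intro exI[of _ "max j n"]) simp
qed

text \<open>From a term equal to \<open>carrier G\<close>, \<open>Z_isolated_step\<close> lowers the
  level one at a time; monotonicity keeps \<open>x [^] n\<close> in every term passed.\<close>

lemma Z_isolated:
  fixes n :: nat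
  assumes "x \<in> carrier G" "n > 0" "x [^] n \<in> Z i"
  shows "x \<in> Z i"
proof -
  obtain c where c: "c \<ge> i" "Z c = carrier G"
    using Z_top by blast
  show ?thesis
    using c(1)
  proof (induction rule: inc_induct)
    case base
    then show ?case
      using assms c by simp
  next
    case (step k)
    then show ?case
      using Z_isolated_step[of x k n] Z_mono[of i k] assms by auto
  qed
qed

section \<open>Rigidity of Cayley graph automorphisms whose displacement is finite modulo a
  term\<close>

lemma Z_center_torsion_free: "torsion_free (group_hom.center_image G (G Mod Z i) (r_coset G (Z i)))"
proof -
  interpret group_hom G "G Mod Z i" "r_coset G (Z i)"
    by (rule Z_hom)
  show ?thesis
  proof (rule center_image_torsion_free)
    fix z and n :: nat
    assume z: "z \<in> central_mod G (r_coset G (Z i))" "n > 0" "Z i #> (z [^] n) = \<one>\<^bsub>G Mod Z i\<^esub>"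
    have "z \<in> carrier G"
      using z(1) by (rule central_mod_carrier)
    then show "Z i #> z = \<one>\<^bsub>G Mod Z i\<^esub>"
      using Z_isolated[of z n i] z normal.rcos_eq_one_iff[OF Z_normal, of _ i] by simp
  qed
qed

text \<open>Descent from a term equal to the whole group. The invariant keeps \<open>d\<close> one
  level above the modulus, so that at the next step commutators with \<open>d\<close> are central
  modulo the smaller term.\<close>

lemma displacement_central:
  assumes S: "symmetric_finite_generating_set G S"
    and f: "f \<in> carrier G \<rightarrow> carrier G"
    and perm: "\<And>x. x \<in> carrier G \<Longrightarrow> bij_betw (\<lambda>s. inv (f x) \<otimes> f (x \<otimes> s)) S S"
    and F: "finite F" "F \<subseteq> carrier G"
    and disp: "\<And>x. x \<in> carrier G \<Longrightarrow> \<exists>y\<in>F. Z j #> (inv x \<otimes> f x) = Z j #> y"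
  obtains d where "d \<in> Z (Suc j)" "\<And>x. x \<in> carrier G \<Longrightarrow> Z j #> f x = Z j #> (x \<otimes> d)"
proof -
  have fc: "f x \<in> carrier G" if "x \<in> carrier G" for x
    using f that by auto
  obtain c where c: "j \<le> c" "Z c = carrier G"
    using Z_top by blast
  have "\<exists>d\<in>Z (Suc j). \<forall>x\<in>carrier G. Z j #> f x = Z j #> (x \<otimes> d)"
    using c(1)
  proof (induction rule: inc_induct)
    case base
    \<comment> \<open>At the top all elements are congruent, so \<open>\<one>\<close> serves as
      \<open>d\<close>.\<close>
    have "\<one> \<in> Z (Suc c)"
      using Z_normal[of "Suc c"] normal_imp_subgroup subgroup.one_closed by blast
    moreover have "Z c #> f x = Z c #> (x \<otimes> \<one>)" if "x \<in> carrier G" for x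
      using that fc c by (subst Z_eq_iff) auto
    ultimately show ?case
      by blast
  next
    case (step n)
    obtain d where d: "d \<in> Z (Suc (Suc n))" "\<And>x. x \<in> carrier G \<Longrightarrow> Z (Suc n) #> f x = Z (Suc n) #> (x \<otimes> d)"
      using step.IH by blast
    interpret q: group_hom G "G Mod Z n" "r_coset G (Z n)"
      by (rule Z_hom)
    have dc: "d \<in> carrier G"
      using d(1) Z_sub by blast
    have comm: "inv d \<otimes> inv g \<otimes> d \<otimes> g \<in> central_mod G (r_coset G (Z n))" if g: "g \<in> carrier G" for g
    proof -
      have "Z (Suc n) #> (g \<otimes> d) = Z (Suc n) #> (d \<otimes> g)"
        using d(1) g unfolding upper_central.simps(2)[of G N "Suc n"] by (rule central_mod_commute)
      then have "inv (g \<otimes> d) \<otimes> (d \<otimes> g) \<in> Z (Suc n)"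
        using Z_eq_iff[of "g \<otimes> d" "d \<otimes> g"] dc g by blast
      then show ?thesis
        using dc g by (simp add: m_assoc inv_mult_group)
    qed
    have dx: "inv d \<otimes> (inv x \<otimes> f x) \<in> central_mod G (r_coset G (Z n))" if x: "x \<in> carrier G" for x
    proof -
      have "inv (x \<otimes> d) \<otimes> f x \<in> Z (Suc n)"
        using d(2)[OF x] Z_eq_iff[of "x \<otimes> d" "f x"] dc x fc by (metis m_closed)
      then show ?thesis
        using dc x fc by (simp add: m_assoc inv_mult_group)
    qed
    \<comment> \<open>Finitely many displacement classes modulo \<open>Z j\<close> remain finitely
      many modulo the larger \<open>Z n\<close>.\<close>
    have fin: "finite ((\<lambda>x. Z n #> (inv x \<otimes> f x)) ` carrier G)"
    proof (rule finite_subset)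
      show "(\<lambda>x. Z n #> (inv x \<otimes> f x)) ` carrier G \<subseteq> r_coset G (Z n) ` F"
      proof clarify
        fix x assume x: "x \<in> carrier G"
        then obtain y where y: "y \<in> F" "Z j #> (inv x \<otimes> f x) = Z j #> y"
          using disp by blast
        have "Z n #> (inv x \<otimes> f x) = Z n #> y"
          using y x fc F by (intro Z_cong_mono[OF step.hyps(1) _ _ y(2)]) auto
        then show "Z n #> (inv x \<otimes> f x) \<in> r_coset G (Z n) ` F"
          using y(1) by (rule image_eqI)
      qed
    qed (use F in simp)
    obtain d' where d': "d' \<in> carrier G" "\<And>x. x \<in> carrier G \<Longrightarrow> Z n #> f x = Z n #> (x \<otimes> d')"
      using q.displacement_constant_mod[OF Z_center_torsion_free S f perm dc comm dx fin] by blast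
    have step1: "inv (f \<one>) \<otimes> f s \<in> S" if "s \<in> S" for s
    proof -
      have "s \<in> carrier G"
        using that S by (auto simp: symmetric_finite_generating_set_def)
      then show ?thesis
        using bij_betw_apply[OF perm[OF one_closed] that] by simp
    qed
    \<comment> \<open>At first only a power of \<open>d'\<close> is known to be central;
      \<open>Z_isolated\<close> removes the exponent and restores the invariant.\<close>
    obtain m :: nat where "m > 0" "d' [^] m \<in> central_mod G (r_coset G (Z n))"
      using q.power_of_displacement_central[OF S f step1 d'] by blast
    then have "d' \<in> Z (Suc n)"
      using Z_isolated[of d' m "Suc n"] d'(1) unfolding upper_central.simps by blast
    then show ?case
      using d'(2) by blast
  qed
  then show thesis
    using that by blast
qed

end

section \<open>Isomorphisms of Cayley graphs\<close>

lemma graph_isomorphism_comp: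
  "graph_isomorphism X Y f \<Longrightarrow> graph_isomorphism Y W g \<Longrightarrow> graph_isomorphism X W (g \<circ> f)"
  unfolding graph_isomorphism_def by (auto intro: bij_betw_trans dest: bij_betwE)

lemma graph_isomorphism_inv:
  assumes "graph_isomorphism X Y f"
  shows "graph_isomorphism Y X (inv_into (fst X) f)"
proof -
  have b: "bij_betw f (fst X) (fst Y)"
    using assms by (simp add: graph_isomorphism_def)
  have "inv_into (fst X) f u \<in> fst X" "f (inv_into (fst X) f u) = u" if "u \<in> fst Y" for u
    using b that bij_betw_apply[OF bij_betw_inv_into[OF b]] by (auto simp: bij_betw_inv_into_right)
  then show ?thesis
    using assms bij_betw_inv_into[OF b] unfolding graph_isomorphism_def by metis
qed

lemma graph_isomorphism_funpow:
  "graph_isomorphism X X f \<Longrightarrow> graph_isomorphism X X (f ^^ n)"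
  by (induction n) (auto intro: graph_isomorphism_comp simp: graph_isomorphism_def[of _ _ id])

lemma fst_Cay [simp]: "fst (Cay G S) = carrier G"
  by (simp add: Cay_def)

lemma (in group) Cay_edge_iff:
  assumes "S \<subseteq> carrier G" "u \<in> carrier G" "v \<in> carrier G"
  shows "(u, v) \<in> snd (Cay G S) \<longleftrightarrow> inv u \<otimes> v \<in> S"
proof
  assume "(u, v) \<in> snd (Cay G S)"
  then obtain s where "s \<in> S" "v = u \<otimes> s"
    by (auto simp: Cay_def)
  then show "inv u \<otimes> v \<in> S"
    using assms by auto
next
  assume s: "inv u \<otimes> v \<in> S"
  have "v = u \<otimes> (inv u \<otimes> v)"
    using assms by simp
  with s show "(u, v) \<in> snd (Cay G S)"
    using assms unfolding Cay_def snd_conv by blast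
qed

lemma (in group) Cay_left_translation:
  assumes S: "S \<subseteq> carrier G" and g: "g \<in> carrier G"
  shows "graph_isomorphism (Cay G S) (Cay G S) (\<lambda>x. g \<otimes> x)"
proof -
  have "bij_betw (\<lambda>x. g \<otimes> x) (carrier G) (carrier G)"
    using g by (intro bij_betw_byWitness[where f' = "\<lambda>x. inv g \<otimes> x"]) auto
  moreover have "inv (g \<otimes> u) \<otimes> (g \<otimes> v) = inv u \<otimes> v" if "u \<in> carrier G" "v \<in> carrier G" for u v
    using that g by (simp add: inv_mult_group m_assoc)
  ultimately show ?thesis
    using S g by (simp add: graph_isomorphism_def Cay_edge_iff)
qed

text \<open>Right multiplication by the generators lists the neighbours of \<open>x\<close> and of
  \<open>\<phi> x\<close>, and a graph isomorphism matches these two lists.\<close>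

lemma Cay_isomorphism_step_bij:
  assumes "group G\<^sub>1" "group G\<^sub>2" and S: "S\<^sub>1 \<subseteq> carrier G\<^sub>1" "S\<^sub>2 \<subseteq> carrier G\<^sub>2"
    and iso: "graph_isomorphism (Cay G\<^sub>1 S\<^sub>1) (Cay G\<^sub>2 S\<^sub>2) \<phi>" and x: "x \<in> carrier G\<^sub>1"
  shows "bij_betw (\<lambda>s. inv\<^bsub>G\<^sub>2\<^esub> \<phi> x \<otimes>\<^bsub>G\<^sub>2\<^esub> \<phi> (x \<otimes>\<^bsub>G\<^sub>1\<^esub> s)) S\<^sub>1 S\<^sub>2"
proof -
  interpret A: group G\<^sub>1 by fact
  interpret B: group G\<^sub>2 by fact
  have b: "bij_betw \<phi> (carrier G\<^sub>1) (carrier G\<^sub>2)"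
    using iso by (simp add: graph_isomorphism_def)
  have \<phi>c: "\<phi> u \<in> carrier G\<^sub>2" if "u \<in> carrier G\<^sub>1" for u
    using b that by (rule bij_betw_apply)
  have edge: "inv\<^bsub>G\<^sub>1\<^esub> u \<otimes>\<^bsub>G\<^sub>1\<^esub> v \<in> S\<^sub>1 \<longleftrightarrow> inv\<^bsub>G\<^sub>2\<^esub> \<phi> u \<otimes>\<^bsub>G\<^sub>2\<^esub> \<phi> v \<in> S\<^sub>2"
    if "u \<in> carrier G\<^sub>1" "v \<in> carrier G\<^sub>1" for u v
    using iso that \<phi>c S by (simp add: graph_isomorphism_def A.Cay_edge_iff B.Cay_edge_iff)
  show ?thesis
  proof (rule bij_betw_imageI)
    show "inj_on (\<lambda>s. inv\<^bsub>G\<^sub>2\<^esub> \<phi> x \<otimes>\<^bsub>G\<^sub>2\<^esub> \<phi> (x \<otimes>\<^bsub>G\<^sub>1\<^esub> s)) S\<^sub>1"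
    proof (rule inj_onI)
      fix s t assume st: "s \<in> S\<^sub>1" "t \<in> S\<^sub>1"
        "inv\<^bsub>G\<^sub>2\<^esub> \<phi> x \<otimes>\<^bsub>G\<^sub>2\<^esub> \<phi> (x \<otimes>\<^bsub>G\<^sub>1\<^esub> s) = inv\<^bsub>G\<^sub>2\<^esub> \<phi> x \<otimes>\<^bsub>G\<^sub>2\<^esub> \<phi> (x \<otimes>\<^bsub>G\<^sub>1\<^esub> t)"
      then have c: "s \<in> carrier G\<^sub>1" "t \<in> carrier G\<^sub>1"
        using S by auto
      then have "\<phi> (x \<otimes>\<^bsub>G\<^sub>1\<^esub> s) = \<phi> (x \<otimes>\<^bsub>G\<^sub>1\<^esub> t)"
        using st(3) x \<phi>c by simp
      then have "x \<otimes>\<^bsub>G\<^sub>1\<^esub> s = x \<otimes>\<^bsub>G\<^sub>1\<^esub> t"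
        using b c x by (auto simp: bij_betw_def dest: inj_onD)
      then show "s = t"
        using c x by simp
    qed
    show "(\<lambda>s. inv\<^bsub>G\<^sub>2\<^esub> \<phi> x \<otimes>\<^bsub>G\<^sub>2\<^esub> \<phi> (x \<otimes>\<^bsub>G\<^sub>1\<^esub> s)) ` S\<^sub>1 = S\<^sub>2"
    proof (intro equalityI subsetI)
      fix t assume "t \<in> (\<lambda>s. inv\<^bsub>G\<^sub>2\<^esub> \<phi> x \<otimes>\<^bsub>G\<^sub>2\<^esub> \<phi> (x \<otimes>\<^bsub>G\<^sub>1\<^esub> s)) ` S\<^sub>1"
      then obtain s where s: "s \<in> S\<^sub>1" "t = inv\<^bsub>G\<^sub>2\<^esub> \<phi> x \<otimes>\<^bsub>G\<^sub>2\<^esub> \<phi> (x \<otimes>\<^bsub>G\<^sub>1\<^esub> s)"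
        by blast
      then have "s \<in> carrier G\<^sub>1"
        using S by auto
      then show "t \<in> S\<^sub>2"
        using s edge[of x "x \<otimes>\<^bsub>G\<^sub>1\<^esub> s"] x by simp
    next
      fix t assume t: "t \<in> S\<^sub>2"
      then have tc: "t \<in> carrier G\<^sub>2"
        using S by auto
      then have "\<phi> x \<otimes>\<^bsub>G\<^sub>2\<^esub> t \<in> \<phi> ` carrier G\<^sub>1"
        using x \<phi>c b by (simp add: bij_betw_def)
      then obtain y where y: "y \<in> carrier G\<^sub>1" "\<phi> y = \<phi> x \<otimes>\<^bsub>G\<^sub>2\<^esub> t"
        by (metis imageE)
      have "inv\<^bsub>G\<^sub>1\<^esub> x \<otimes>\<^bsub>G\<^sub>1\<^esub> y \<in> S\<^sub>1"
        using edge[of x y] x y t tc \<phi>c by simp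
      moreover have "t = inv\<^bsub>G\<^sub>2\<^esub> \<phi> x \<otimes>\<^bsub>G\<^sub>2\<^esub> \<phi> (x \<otimes>\<^bsub>G\<^sub>1\<^esub> (inv\<^bsub>G\<^sub>1\<^esub> x \<otimes>\<^bsub>G\<^sub>1\<^esub> y))"
        using x y tc \<phi>c by simp
      ultimately show "t \<in> (\<lambda>s. inv\<^bsub>G\<^sub>2\<^esub> \<phi> x \<otimes>\<^bsub>G\<^sub>2\<^esub> \<phi> (x \<otimes>\<^bsub>G\<^sub>1\<^esub> s)) ` S\<^sub>1"
        by (rule image_eqI[rotated])
    qed
  qed
qed

text \<open>A path from \<open>x\<close> spelling \<open>z\<close> in generators goes to a path of
  the same length, so the displacement is a product of that many elements of
  \<open>S\<^sub>2\<close>. Since \<open>F\<close> is chosen before \<open>\<phi>\<close> and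
  \<open>x\<close>, one set serves all iterates of an automorphism.\<close>

lemma Cay_isomorphism_finite_displacement:
  assumes "group G\<^sub>1" "group G\<^sub>2"
    and S\<^sub>1: "symmetric_finite_generating_set G\<^sub>1 S\<^sub>1" and S\<^sub>2: "symmetric_finite_generating_set G\<^sub>2 S\<^sub>2"
    and z: "z \<in> carrier G\<^sub>1"
  shows "\<exists>F. finite F \<and> F \<subseteq> carrier G\<^sub>2 \<and>
           (\<forall>\<phi>. graph_isomorphism (Cay G\<^sub>1 S\<^sub>1) (Cay G\<^sub>2 S\<^sub>2) \<phi> \<longrightarrow>
             (\<forall>x\<in>carrier G\<^sub>1. inv\<^bsub>G\<^sub>2\<^esub> \<phi> x \<otimes>\<^bsub>G\<^sub>2\<^esub> \<phi> (x \<otimes>\<^bsub>G\<^sub>1\<^esub> z) \<in> F))"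
    (is "\<exists>F. ?P z F")
proof -
  interpret A: group G\<^sub>1 by fact
  interpret B: group G\<^sub>2 by fact
  have S: "S\<^sub>1 \<subseteq> carrier G\<^sub>1" "S\<^sub>2 \<subseteq> carrier G\<^sub>2" "finite S\<^sub>2"
    using S\<^sub>1 S\<^sub>2 by (auto simp: symmetric_finite_generating_set_def)
  have \<phi>c: "\<phi> u \<in> carrier G\<^sub>2"
    if "graph_isomorphism (Cay G\<^sub>1 S\<^sub>1) (Cay G\<^sub>2 S\<^sub>2) \<phi>" "u \<in> carrier G\<^sub>1" for \<phi> u
    using that by (auto simp: graph_isomorphism_def dest: bij_betw_apply)
  show ?thesis
    using S\<^sub>1 A.one_closed _ _ z
  proof (rule A.right_translation_induct)
    show "\<exists>F. ?P \<one>\<^bsub>G\<^sub>1\<^esub> F"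
      using \<phi>c by (intro exI[of _ "{\<one>\<^bsub>G\<^sub>2\<^esub>}"]) auto
  next
    fix w s assume w: "w \<in> carrier G\<^sub>1" "s \<in> S\<^sub>1" "\<exists>F. ?P w F"
    then obtain F where F: "?P w F"
      by blast
    have s: "s \<in> carrier G\<^sub>1"
      using w S by auto
    have "?P (w \<otimes>\<^bsub>G\<^sub>1\<^esub> s) ((\<lambda>(a, b). a \<otimes>\<^bsub>G\<^sub>2\<^esub> b) ` (F \<times> S\<^sub>2))"
    proof (intro conjI allI impI ballI)
      show "finite ((\<lambda>(a, b). a \<otimes>\<^bsub>G\<^sub>2\<^esub> b) ` (F \<times> S\<^sub>2))"
        using F S by simp
      show "(\<lambda>(a, b). a \<otimes>\<^bsub>G\<^sub>2\<^esub> b) ` (F \<times> S\<^sub>2) \<subseteq> carrier G\<^sub>2"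
        using F S by auto
      fix \<phi> x assume iso: "graph_isomorphism (Cay G\<^sub>1 S\<^sub>1) (Cay G\<^sub>2 S\<^sub>2) \<phi>" and x: "x \<in> carrier G\<^sub>1"
      let ?a = "inv\<^bsub>G\<^sub>2\<^esub> \<phi> x \<otimes>\<^bsub>G\<^sub>2\<^esub> \<phi> (x \<otimes>\<^bsub>G\<^sub>1\<^esub> w)"
      let ?b = "inv\<^bsub>G\<^sub>2\<^esub> \<phi> (x \<otimes>\<^bsub>G\<^sub>1\<^esub> w) \<otimes>\<^bsub>G\<^sub>2\<^esub> \<phi> (x \<otimes>\<^bsub>G\<^sub>1\<^esub> w \<otimes>\<^bsub>G\<^sub>1\<^esub> s)"
      have "?a \<in> F"
        using F iso x by blast
      moreover have "?b \<in> S\<^sub>2"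
        using bij_betw_apply[OF Cay_isomorphism_step_bij[OF assms(1,2) S(1,2) iso] w(2)] x w(1) by simp
      moreover have "inv\<^bsub>G\<^sub>2\<^esub> \<phi> x \<otimes>\<^bsub>G\<^sub>2\<^esub> \<phi> (x \<otimes>\<^bsub>G\<^sub>1\<^esub> (w \<otimes>\<^bsub>G\<^sub>1\<^esub> s)) = ?a \<otimes>\<^bsub>G\<^sub>2\<^esub> ?b"
        using x w(1) s \<phi>c[OF iso] by (simp add: B.m_assoc A.m_assoc)
      ultimately show "inv\<^bsub>G\<^sub>2\<^esub> \<phi> x \<otimes>\<^bsub>G\<^sub>2\<^esub> \<phi> (x \<otimes>\<^bsub>G\<^sub>1\<^esub> (w \<otimes>\<^bsub>G\<^sub>1\<^esub> s)) \<in> (\<lambda>(a, b). a \<otimes>\<^bsub>G\<^sub>2\<^esub> b) ` (F \<times> S\<^sub>2)"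
        by force
    qed
    then show "\<exists>F. ?P (w \<otimes>\<^bsub>G\<^sub>1\<^esub> s) F"
      by blast
  qed
qed

context finite_by_torsion_free_nilpotent
begin

lemma Z_cong_mult:
  assumes "Z i #> a = Z i #> a'" "Z i #> b = Z i #> b'"
    and "a \<in> carrier G" "a' \<in> carrier G" "b \<in> carrier G" "b' \<in> carrier G"
  shows "Z i #> (a \<otimes> b) = Z i #> (a' \<otimes> b')"
  using assms by (metis group_hom.hom_mult[OF Z_hom])

lemma Z_cong_cancel:
  assumes "Z i #> (a \<otimes> b) = Z i #> (a \<otimes> b')" "a \<in> carrier G" "b \<in> carrier G" "b' \<in> carrier G"
  shows "Z i #> b = Z i #> b'"
  using assms by (simp add: Z_eq_iff inv_mult_group m_assoc)

text \<open>By the pigeonhole principle two powers agree modulo \<open>Z i\<close>; hence a positive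
  power lies in \<open>Z i\<close>, and \<open>Z_isolated\<close> applies.\<close>

lemma Z_finite_powers:
  assumes x: "x \<in> carrier G" and F: "finite F" and pw: "\<And>k::nat. \<exists>y\<in>F. Z i #> (x [^] k) = Z i #> y"
  shows "x \<in> Z i"
proof -
  have "range (\<lambda>k::nat. Z i #> (x [^] k)) \<subseteq> r_coset G (Z i) ` F"
    using pw by auto
  then have "finite (range (\<lambda>k::nat. Z i #> (x [^] k)))"
    using F finite_surj by blast
  then have "\<not> inj (\<lambda>k::nat. Z i #> (x [^] k))"
    using finite_imageD infinite_UNIV_nat by blast
  then obtain a b :: nat where "a < b" "Z i #> (x [^] a) = Z i #> (x [^] b)"
    unfolding inj_def by (metis linorder_neqE_nat)
  moreover from \<open>a < b\<close> have "x [^] b = x [^] a \<otimes> x [^] (b - a)"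
    using x by (simp add: nat_pow_mult)
  ultimately have "x [^] (b - a) \<in> Z i"
    using x by (simp add: Z_eq_iff)
  then show ?thesis
    using Z_isolated[OF x, of "b - a"] \<open>a < b\<close> by simp
qed

end

section \<open>Transport of the central series along an isomorphism of Cayley graphs\<close>

locale cayley_isomorphism =
  A: finite_by_torsion_free_nilpotent G\<^sub>1 N\<^sub>1 + B: finite_by_torsion_free_nilpotent G\<^sub>2 N\<^sub>2
  for G\<^sub>1 (structure) and N\<^sub>1 and G\<^sub>2 (structure) and N\<^sub>2 +
  fixes S\<^sub>1 S\<^sub>2 \<phi>
  assumes S\<^sub>1: "symmetric_finite_generating_set G\<^sub>1 S\<^sub>1" and S\<^sub>2: "symmetric_finite_generating_set G\<^sub>2 S\<^sub>2"
    and iso: "graph_isomorphism (Cay G\<^sub>1 S\<^sub>1) (Cay G\<^sub>2 S\<^sub>2) \<phi>"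
begin

abbreviation "\<phi>' \<equiv> inv_into (carrier G\<^sub>1) \<phi>"

text \<open>The hypotheses are symmetric in the two groups, so facts about \<open>\<phi>\<close> can
  be read for its inverse; \<open>coset_reflected\<close> relies on this.\<close>

lemma cayley_isomorphism_inverse: "cayley_isomorphism G\<^sub>2 N\<^sub>2 G\<^sub>1 N\<^sub>1 S\<^sub>2 S\<^sub>1 \<phi>'"
  using graph_isomorphism_inv[OF iso] S\<^sub>1 S\<^sub>2
  by (simp add: cayley_isomorphism_def cayley_isomorphism_axioms_def
      A.finite_by_torsion_free_nilpotent_axioms B.finite_by_torsion_free_nilpotent_axioms)

lemma S_carrier: "S\<^sub>1 \<subseteq> carrier G\<^sub>1" "S\<^sub>2 \<subseteq> carrier G\<^sub>2"
  using S\<^sub>1 S\<^sub>2 by (auto simp: symmetric_finite_generating_set_def)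

lemma \<phi>_bij: "bij_betw \<phi> (carrier G\<^sub>1) (carrier G\<^sub>2)"
  using iso by (simp add: graph_isomorphism_def)

lemma \<phi>_closed [simp]: "x \<in> carrier G\<^sub>1 \<Longrightarrow> \<phi> x \<in> carrier G\<^sub>2"
  using \<phi>_bij by (rule bij_betw_apply)

lemma \<phi>'_closed [simp]: "y \<in> carrier G\<^sub>2 \<Longrightarrow> \<phi>' y \<in> carrier G\<^sub>1"
  using bij_betw_inv_into[OF \<phi>_bij] by (rule bij_betw_apply)

lemma \<phi>_\<phi>' [simp]: "y \<in> carrier G\<^sub>2 \<Longrightarrow> \<phi> (\<phi>' y) = y"
  using \<phi>_bij by (rule bij_betw_inv_into_right)

lemma \<phi>'_\<phi> [simp]: "x \<in> carrier G\<^sub>1 \<Longrightarrow> \<phi>' (\<phi> x) = x"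
  using \<phi>_bij by (rule bij_betw_inv_into_left)

lemma conjugate_translation:
  assumes "g \<in> carrier G\<^sub>1"
  shows "graph_isomorphism (Cay G\<^sub>2 S\<^sub>2) (Cay G\<^sub>2 S\<^sub>2) (\<lambda>y. \<phi> (g \<otimes>\<^bsub>G\<^sub>1\<^esub> \<phi>' y))"
  using graph_isomorphism_comp[OF graph_isomorphism_comp[OF graph_isomorphism_inv[OF iso]
        A.Cay_left_translation[OF S_carrier(1) assms]] iso]
  by (simp add: o_def)

text \<open>\<open>displacement_central\<close> is applied to the left translation by
  \<open>g\<close> conjugated by \<open>\<phi>\<close>; evaluating at the points
  \<open>\<phi> x\<close> removes the inverse map again.\<close>

lemma translation_displacement_central:
  assumes g: "g \<in> carrier G\<^sub>1" and F: "finite F" "F \<subseteq> carrier G\<^sub>2"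
    and disp: "\<And>x. x \<in> carrier G\<^sub>1 \<Longrightarrow>
      \<exists>y\<in>F. B.Z j #>\<^bsub>G\<^sub>2\<^esub> (inv\<^bsub>G\<^sub>2\<^esub> \<phi> x \<otimes>\<^bsub>G\<^sub>2\<^esub> \<phi> (g \<otimes>\<^bsub>G\<^sub>1\<^esub> x)) = B.Z j #>\<^bsub>G\<^sub>2\<^esub> y"
  obtains d where "d \<in> B.Z (Suc j)"
    "\<And>x. x \<in> carrier G\<^sub>1 \<Longrightarrow> B.Z j #>\<^bsub>G\<^sub>2\<^esub> \<phi> (g \<otimes>\<^bsub>G\<^sub>1\<^esub> x) = B.Z j #>\<^bsub>G\<^sub>2\<^esub> (\<phi> x \<otimes>\<^bsub>G\<^sub>2\<^esub> d)"
proof -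
  let ?f = "\<lambda>y. \<phi> (g \<otimes>\<^bsub>G\<^sub>1\<^esub> \<phi>' y)"
  have perm: "bij_betw (\<lambda>s. inv\<^bsub>G\<^sub>2\<^esub> (?f x) \<otimes>\<^bsub>G\<^sub>2\<^esub> ?f (x \<otimes>\<^bsub>G\<^sub>2\<^esub> s)) S\<^sub>2 S\<^sub>2" if "x \<in> carrier G\<^sub>2" for x
    using Cay_isomorphism_step_bij[OF B.is_group B.is_group S_carrier(2,2) conjugate_translation[OF g] that] .
  have fc: "?f \<in> carrier G\<^sub>2 \<rightarrow> carrier G\<^sub>2"
    using g by auto
  have "\<exists>y\<in>F. B.Z j #>\<^bsub>G\<^sub>2\<^esub> (inv\<^bsub>G\<^sub>2\<^esub> y' \<otimes>\<^bsub>G\<^sub>2\<^esub> ?f y') = B.Z j #>\<^bsub>G\<^sub>2\<^esub> y" if "y' \<in> carrier G\<^sub>2" for y'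
    using disp[of "\<phi>' y'"] that by simp
  then obtain d where d: "d \<in> B.Z (Suc j)"
    "\<And>y. y \<in> carrier G\<^sub>2 \<Longrightarrow> B.Z j #>\<^bsub>G\<^sub>2\<^esub> ?f y = B.Z j #>\<^bsub>G\<^sub>2\<^esub> (y \<otimes>\<^bsub>G\<^sub>2\<^esub> d)"
    using B.displacement_central[OF S\<^sub>2 fc perm F] by blast
  have "B.Z j #>\<^bsub>G\<^sub>2\<^esub> \<phi> (g \<otimes>\<^bsub>G\<^sub>1\<^esub> x) = B.Z j #>\<^bsub>G\<^sub>2\<^esub> (\<phi> x \<otimes>\<^bsub>G\<^sub>2\<^esub> d)" if "x \<in> carrier G\<^sub>1" for x
    using d(2)[of "\<phi> x"] that by simp
  then show thesis
    by (rule that[OF d(1)])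
qed

text \<open>Conjugates of \<open>n\<close> stay in the finite \<open>N\<^sub>1\<close>, so left
  translation by \<open>n\<close> has finite displacement and acts modulo \<open>N\<^sub>2\<close>
  as a right factor \<open>d\<close>. Iteration at the identity yields the powers of
  \<open>d\<close>; as the powers of \<open>n\<close> also stay in \<open>N\<^sub>1\<close>,
  finitely many classes occur and \<open>d\<close> lies in \<open>N\<^sub>2\<close>.\<close>

lemma kernel_coset_preserved:
  assumes n: "n \<in> N\<^sub>1" and x: "x \<in> carrier G\<^sub>1"
  shows "N\<^sub>2 #>\<^bsub>G\<^sub>2\<^esub> \<phi> (n \<otimes>\<^bsub>G\<^sub>1\<^esub> x) = N\<^sub>2 #>\<^bsub>G\<^sub>2\<^esub> \<phi> x"
proof -
  interpret N: normal N\<^sub>1 G\<^sub>1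
    by (rule A.N_normal)
  have nc: "n \<in> carrier G\<^sub>1"
    using n by auto
  obtain E where E: "\<And>z. z \<in> carrier G\<^sub>1 \<Longrightarrow> finite (E z) \<and> E z \<subseteq> carrier G\<^sub>2 \<and>
      (\<forall>x\<in>carrier G\<^sub>1. inv\<^bsub>G\<^sub>2\<^esub> \<phi> x \<otimes>\<^bsub>G\<^sub>2\<^esub> \<phi> (x \<otimes>\<^bsub>G\<^sub>1\<^esub> z) \<in> E z)"
    using Cay_isomorphism_finite_displacement[OF A.is_group B.is_group S\<^sub>1 S\<^sub>2] iso by metis
  define F where "F = (\<Union>z\<in>N\<^sub>1. E z)"
  have F: "finite F" "F \<subseteq> carrier G\<^sub>2"
    unfolding F_def using E[OF N.mem_carrier] A.N_finite by (simp_all add: UN_subset_iff)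
  have "inv\<^bsub>G\<^sub>2\<^esub> \<phi> x \<otimes>\<^bsub>G\<^sub>2\<^esub> \<phi> (n \<otimes>\<^bsub>G\<^sub>1\<^esub> x) \<in> F" if x: "x \<in> carrier G\<^sub>1" for x
  proof -
    have "inv\<^bsub>G\<^sub>1\<^esub> x \<otimes>\<^bsub>G\<^sub>1\<^esub> n \<otimes>\<^bsub>G\<^sub>1\<^esub> x \<in> N\<^sub>1"
      using n x by (rule N.inv_op_closed1[rotated])
    moreover have "n \<otimes>\<^bsub>G\<^sub>1\<^esub> x = x \<otimes>\<^bsub>G\<^sub>1\<^esub> (inv\<^bsub>G\<^sub>1\<^esub> x \<otimes>\<^bsub>G\<^sub>1\<^esub> n \<otimes>\<^bsub>G\<^sub>1\<^esub> x)"
      using nc x by (simp add: A.m_assoc)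
    ultimately show ?thesis
      unfolding F_def using E x by (metis UN_I N.mem_carrier)
  qed
  then have "\<exists>y\<in>F. B.Z 0 #>\<^bsub>G\<^sub>2\<^esub> (inv\<^bsub>G\<^sub>2\<^esub> \<phi> x \<otimes>\<^bsub>G\<^sub>2\<^esub> \<phi> (n \<otimes>\<^bsub>G\<^sub>1\<^esub> x)) = B.Z 0 #>\<^bsub>G\<^sub>2\<^esub> y"
    if "x \<in> carrier G\<^sub>1" for x
    using that by blast
  then obtain d where d: "d \<in> B.Z (Suc 0)"
    "\<And>x. x \<in> carrier G\<^sub>1 \<Longrightarrow> B.Z 0 #>\<^bsub>G\<^sub>2\<^esub> \<phi> (n \<otimes>\<^bsub>G\<^sub>1\<^esub> x) = B.Z 0 #>\<^bsub>G\<^sub>2\<^esub> (\<phi> x \<otimes>\<^bsub>G\<^sub>2\<^esub> d)"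
    using translation_displacement_central[OF nc F, of 0] by blast
  have dc: "d \<in> carrier G\<^sub>2"
    using d(1) B.Z_sub by blast
  have pw: "B.Z 0 #>\<^bsub>G\<^sub>2\<^esub> \<phi> (n [^]\<^bsub>G\<^sub>1\<^esub> k) = B.Z 0 #>\<^bsub>G\<^sub>2\<^esub> (\<phi> \<one>\<^bsub>G\<^sub>1\<^esub> \<otimes>\<^bsub>G\<^sub>2\<^esub> d [^]\<^bsub>G\<^sub>2\<^esub> k)" for k :: nat
  proof (induction k)
    case (Suc k)
    have "B.Z 0 #>\<^bsub>G\<^sub>2\<^esub> \<phi> (n [^]\<^bsub>G\<^sub>1\<^esub> Suc k) = B.Z 0 #>\<^bsub>G\<^sub>2\<^esub> (\<phi> (n [^]\<^bsub>G\<^sub>1\<^esub> k) \<otimes>\<^bsub>G\<^sub>2\<^esub> d)"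
      using d(2)[of "n [^]\<^bsub>G\<^sub>1\<^esub> k"] nc A.nat_pow_Suc2[OF nc] by (simp del: upper_central.simps)
    also have "\<dots> = B.Z 0 #>\<^bsub>G\<^sub>2\<^esub> (\<phi> \<one>\<^bsub>G\<^sub>1\<^esub> \<otimes>\<^bsub>G\<^sub>2\<^esub> d [^]\<^bsub>G\<^sub>2\<^esub> k \<otimes>\<^bsub>G\<^sub>2\<^esub> d)"
      using Suc nc dc by (intro B.Z_cong_mult) auto
    finally show ?case
      using dc by (simp add: B.m_assoc)
  qed simp
  have "d \<in> B.Z 0"
  proof (rule B.Z_finite_powers[OF dc])
    show "finite ((\<lambda>m. inv\<^bsub>G\<^sub>2\<^esub> \<phi> \<one>\<^bsub>G\<^sub>1\<^esub> \<otimes>\<^bsub>G\<^sub>2\<^esub> \<phi> m) ` N\<^sub>1)"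
      using A.N_finite by simp
    fix k :: nat
    have nk: "n [^]\<^bsub>G\<^sub>1\<^esub> k \<in> N\<^sub>1"
      using n by (induction k) auto
    have "B.Z 0 #>\<^bsub>G\<^sub>2\<^esub> (inv\<^bsub>G\<^sub>2\<^esub> \<phi> \<one>\<^bsub>G\<^sub>1\<^esub> \<otimes>\<^bsub>G\<^sub>2\<^esub> (\<phi> \<one>\<^bsub>G\<^sub>1\<^esub> \<otimes>\<^bsub>G\<^sub>2\<^esub> d [^]\<^bsub>G\<^sub>2\<^esub> k))
        = B.Z 0 #>\<^bsub>G\<^sub>2\<^esub> (inv\<^bsub>G\<^sub>2\<^esub> \<phi> \<one>\<^bsub>G\<^sub>1\<^esub> \<otimes>\<^bsub>G\<^sub>2\<^esub> \<phi> (n [^]\<^bsub>G\<^sub>1\<^esub> k))"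
      using pw[of k] nc dc by (intro B.Z_cong_mult) auto
    then show "\<exists>y\<in>(\<lambda>m. inv\<^bsub>G\<^sub>2\<^esub> \<phi> \<one>\<^bsub>G\<^sub>1\<^esub> \<otimes>\<^bsub>G\<^sub>2\<^esub> \<phi> m) ` N\<^sub>1. B.Z 0 #>\<^bsub>G\<^sub>2\<^esub> (d [^]\<^bsub>G\<^sub>2\<^esub> k) = B.Z 0 #>\<^bsub>G\<^sub>2\<^esub> y"
      using nk dc by auto
  qed
  then have "B.Z 0 #>\<^bsub>G\<^sub>2\<^esub> \<phi> x = B.Z 0 #>\<^bsub>G\<^sub>2\<^esub> (\<phi> x \<otimes>\<^bsub>G\<^sub>2\<^esub> d)"
    using x dc by (subst B.Z_eq_iff) auto
  then show ?thesis
    using d(2)[OF x] by simp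
qed

text \<open>Left translation by \<open>z\<close> is a graph automorphism, right translation by
  \<open>z\<close> has finite displacement under \<open>\<phi>\<close>; modulo \<open>A.Z j\<close>
  the two agree, and \<open>pres\<close> carries this over to \<open>G\<^sub>2\<close>. Keeping
  \<open>pres\<close> as a hypothesis permits use inside the induction for
  \<open>coset_preserved\<close>.\<close>

lemma central_shift:
  assumes pres: "\<And>x y. x \<in> carrier G\<^sub>1 \<Longrightarrow> y \<in> carrier G\<^sub>1 \<Longrightarrow>
      A.Z j #>\<^bsub>G\<^sub>1\<^esub> x = A.Z j #>\<^bsub>G\<^sub>1\<^esub> y \<Longrightarrow> B.Z j #>\<^bsub>G\<^sub>2\<^esub> \<phi> x = B.Z j #>\<^bsub>G\<^sub>2\<^esub> \<phi> y"
    and z: "z \<in> A.Z (Suc j)"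
  obtains d where "d \<in> B.Z (Suc j)"
    "\<And>x. x \<in> carrier G\<^sub>1 \<Longrightarrow> B.Z j #>\<^bsub>G\<^sub>2\<^esub> \<phi> (x \<otimes>\<^bsub>G\<^sub>1\<^esub> z) = B.Z j #>\<^bsub>G\<^sub>2\<^esub> (\<phi> x \<otimes>\<^bsub>G\<^sub>2\<^esub> d)"
proof -
  have zc: "z \<in> carrier G\<^sub>1"
    using z A.Z_sub by blast
  have comm: "B.Z j #>\<^bsub>G\<^sub>2\<^esub> \<phi> (z \<otimes>\<^bsub>G\<^sub>1\<^esub> x) = B.Z j #>\<^bsub>G\<^sub>2\<^esub> \<phi> (x \<otimes>\<^bsub>G\<^sub>1\<^esub> z)" if x: "x \<in> carrier G\<^sub>1" for x
    using central_mod_commute[OF z[unfolded upper_central.simps] x] x zc by (intro pres) auto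
  obtain F where F: "finite F" "F \<subseteq> carrier G\<^sub>2"
    "\<And>x. x \<in> carrier G\<^sub>1 \<Longrightarrow> inv\<^bsub>G\<^sub>2\<^esub> \<phi> x \<otimes>\<^bsub>G\<^sub>2\<^esub> \<phi> (x \<otimes>\<^bsub>G\<^sub>1\<^esub> z) \<in> F"
    using Cay_isomorphism_finite_displacement[OF A.is_group B.is_group S\<^sub>1 S\<^sub>2 zc] iso by blast
  have "\<exists>y\<in>F. B.Z j #>\<^bsub>G\<^sub>2\<^esub> (inv\<^bsub>G\<^sub>2\<^esub> \<phi> x \<otimes>\<^bsub>G\<^sub>2\<^esub> \<phi> (z \<otimes>\<^bsub>G\<^sub>1\<^esub> x)) = B.Z j #>\<^bsub>G\<^sub>2\<^esub> y" if x: "x \<in> carrier G\<^sub>1" for x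
  proof
    show "B.Z j #>\<^bsub>G\<^sub>2\<^esub> (inv\<^bsub>G\<^sub>2\<^esub> \<phi> x \<otimes>\<^bsub>G\<^sub>2\<^esub> \<phi> (z \<otimes>\<^bsub>G\<^sub>1\<^esub> x)) = B.Z j #>\<^bsub>G\<^sub>2\<^esub> (inv\<^bsub>G\<^sub>2\<^esub> \<phi> x \<otimes>\<^bsub>G\<^sub>2\<^esub> \<phi> (x \<otimes>\<^bsub>G\<^sub>1\<^esub> z))"
      using comm[OF x] x zc by (intro B.Z_cong_mult) auto
  qed (use F x in auto)
  then obtain d where "d \<in> B.Z (Suc j)"
    "\<And>x. x \<in> carrier G\<^sub>1 \<Longrightarrow> B.Z j #>\<^bsub>G\<^sub>2\<^esub> \<phi> (z \<otimes>\<^bsub>G\<^sub>1\<^esub> x) = B.Z j #>\<^bsub>G\<^sub>2\<^esub> (\<phi> x \<otimes>\<^bsub>G\<^sub>2\<^esub> d)"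
    using translation_displacement_central[OF zc F(1,2), of j] by blast
  then show thesis
    using that comm by simp
qed

text \<open>Elements of one coset at level \<open>Suc j\<close> differ by a right factor in
  \<open>A.Z (Suc j)\<close>. By \<open>central_shift\<close> their images differ modulo
  \<open>B.Z j\<close> by a factor in \<open>B.Z (Suc j)\<close>, which is trivial at level
  \<open>Suc j\<close>.\<close>

lemma coset_preserved:
  assumes "x \<in> carrier G\<^sub>1" "y \<in> carrier G\<^sub>1" "A.Z j #>\<^bsub>G\<^sub>1\<^esub> x = A.Z j #>\<^bsub>G\<^sub>1\<^esub> y"
  shows "B.Z j #>\<^bsub>G\<^sub>2\<^esub> \<phi> x = B.Z j #>\<^bsub>G\<^sub>2\<^esub> \<phi> y"
  using assms
proof (induction j arbitrary: x y)
  case 0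
  interpret N: normal N\<^sub>1 G\<^sub>1
    by (rule A.N_normal)
  have "y \<in> N\<^sub>1 #>\<^bsub>G\<^sub>1\<^esub> x"
    using 0 A.rcos_self[of y N\<^sub>1] N.is_subgroup by simp
  then obtain n where "n \<in> N\<^sub>1" "y = n \<otimes>\<^bsub>G\<^sub>1\<^esub> x"
    by (auto simp: r_coset_def)
  then show ?case
    using kernel_coset_preserved[of n x] 0 by simp
next
  case (Suc j)
  let ?z = "inv\<^bsub>G\<^sub>1\<^esub> x \<otimes>\<^bsub>G\<^sub>1\<^esub> y"
  have "?z \<in> A.Z (Suc j)"
    using Suc.prems A.Z_eq_iff[of x y "Suc j"] by blast
  then obtain d where d: "d \<in> B.Z (Suc j)"
    "\<And>x. x \<in> carrier G\<^sub>1 \<Longrightarrow> B.Z j #>\<^bsub>G\<^sub>2\<^esub> \<phi> (x \<otimes>\<^bsub>G\<^sub>1\<^esub> ?z) = B.Z j #>\<^bsub>G\<^sub>2\<^esub> (\<phi> x \<otimes>\<^bsub>G\<^sub>2\<^esub> d)"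
    using central_shift[OF Suc.IH] by blast
  have dc: "d \<in> carrier G\<^sub>2"
    using d(1) B.Z_sub by blast
  have "B.Z j #>\<^bsub>G\<^sub>2\<^esub> \<phi> y = B.Z j #>\<^bsub>G\<^sub>2\<^esub> (\<phi> x \<otimes>\<^bsub>G\<^sub>2\<^esub> d)"
    using d(2)[OF Suc.prems(1)] Suc.prems(1,2) by simp
  then have "B.Z (Suc j) #>\<^bsub>G\<^sub>2\<^esub> \<phi> y = B.Z (Suc j) #>\<^bsub>G\<^sub>2\<^esub> (\<phi> x \<otimes>\<^bsub>G\<^sub>2\<^esub> d)"
    using Suc.prems dc by (intro B.Z_cong_mono[of j "Suc j"]) auto
  also have "\<dots> = B.Z (Suc j) #>\<^bsub>G\<^sub>2\<^esub> \<phi> x"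
    using B.Z_eq_iff[of "\<phi> x" "\<phi> x \<otimes>\<^bsub>G\<^sub>2\<^esub> d" "Suc j"] d(1) dc Suc.prems(1) by simp
  finally show ?case ..
qed

lemma coset_reflected:
  assumes "x \<in> carrier G\<^sub>1" "y \<in> carrier G\<^sub>1" "B.Z j #>\<^bsub>G\<^sub>2\<^esub> \<phi> x = B.Z j #>\<^bsub>G\<^sub>2\<^esub> \<phi> y"
  shows "A.Z j #>\<^bsub>G\<^sub>1\<^esub> x = A.Z j #>\<^bsub>G\<^sub>1\<^esub> y"
  using cayley_isomorphism.coset_preserved[OF cayley_isomorphism_inverse, of "\<phi> x" "\<phi> y" j] assms
  by simp

text \<open>Descent from the top: the congruence one level up places the defect \<open>D\<close> in
  \<open>B.Z (Suc n)\<close>. The normalisation \<open>one\<close> makes \<open>f\<close> fix the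
  identity, which bounds the orbit of \<open>\<phi> x\<close> and thereby the classes of powers of
  \<open>D\<close>.\<close>

lemma multiplicative_mod:
  assumes one: "\<phi> \<one>\<^bsub>G\<^sub>1\<^esub> = \<one>\<^bsub>G\<^sub>2\<^esub>" and g: "g \<in> carrier G\<^sub>1" and x: "x \<in> carrier G\<^sub>1"
  shows "B.Z j #>\<^bsub>G\<^sub>2\<^esub> \<phi> (g \<otimes>\<^bsub>G\<^sub>1\<^esub> x) = B.Z j #>\<^bsub>G\<^sub>2\<^esub> (\<phi> g \<otimes>\<^bsub>G\<^sub>2\<^esub> \<phi> x)"
proof -
  obtain c where c: "j \<le> c" "B.Z c = carrier G\<^sub>2"
    using B.Z_top by blast
  show ?thesis
    using c(1)
  proof (induction rule: inc_induct)
    case base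
    show ?case
      using c g x by (subst B.Z_eq_iff) auto
  next
    case (step n)
    define f where "f y = inv\<^bsub>G\<^sub>2\<^esub> \<phi> g \<otimes>\<^bsub>G\<^sub>2\<^esub> \<phi> (g \<otimes>\<^bsub>G\<^sub>1\<^esub> \<phi>' y)" for y
    define D where "D = inv\<^bsub>G\<^sub>2\<^esub> \<phi> x \<otimes>\<^bsub>G\<^sub>2\<^esub> f (\<phi> x)"
    have fc: "f y \<in> carrier G\<^sub>2" if "y \<in> carrier G\<^sub>2" for y
      using that g by (simp add: f_def)
    have f_iso: "graph_isomorphism (Cay G\<^sub>2 S\<^sub>2) (Cay G\<^sub>2 S\<^sub>2) f"
      using graph_isomorphism_comp[OF conjugate_translation[OF g] B.Cay_left_translation[OF S_carrier(2), of "inv\<^bsub>G\<^sub>2\<^esub> \<phi> g"]] g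
      by (simp add: o_def f_def[abs_def])
    have Dc: "D \<in> carrier G\<^sub>2"
      using fc x by (simp add: D_def)
    have f\<phi>x: "f (\<phi> x) = \<phi> x \<otimes>\<^bsub>G\<^sub>2\<^esub> D"
      using fc x by (simp add: D_def)
    have D: "D \<in> B.Z (Suc n)"
    proof -
      have "inv\<^bsub>G\<^sub>2\<^esub> (\<phi> g \<otimes>\<^bsub>G\<^sub>2\<^esub> \<phi> x) \<otimes>\<^bsub>G\<^sub>2\<^esub> \<phi> (g \<otimes>\<^bsub>G\<^sub>1\<^esub> x) \<in> B.Z (Suc n)"
        using step.IH B.Z_eq_iff[of "\<phi> g \<otimes>\<^bsub>G\<^sub>2\<^esub> \<phi> x" "\<phi> (g \<otimes>\<^bsub>G\<^sub>1\<^esub> x)" "Suc n"] g x by simp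
      then show ?thesis
        using g x by (simp add: D_def f_def B.inv_mult_group B.m_assoc)
    qed
    \<comment> \<open>Through \<open>\<phi>\<close>, right multiplication by \<open>w\<close> at
      \<open>x\<close> becomes right multiplication by some \<open>?z\<close> in
      \<open>A.Z (Suc n)\<close>; \<open>central_shift\<close> then provides one factor
      \<open>d\<close> valid both at \<open>x\<close> and at the translate of \<open>x\<close> by
      \<open>g\<close>.\<close>
    have f_shift: "B.Z n #>\<^bsub>G\<^sub>2\<^esub> f (\<phi> x \<otimes>\<^bsub>G\<^sub>2\<^esub> w) = B.Z n #>\<^bsub>G\<^sub>2\<^esub> (f (\<phi> x) \<otimes>\<^bsub>G\<^sub>2\<^esub> w)" if w: "w \<in> B.Z (Suc n)" for w
    proof -
      have wc: "w \<in> carrier G\<^sub>2"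
        using w B.Z_sub by blast
      define y where "y = \<phi>' (\<phi> x \<otimes>\<^bsub>G\<^sub>2\<^esub> w)"
      have y: "y \<in> carrier G\<^sub>1" "\<phi> y = \<phi> x \<otimes>\<^bsub>G\<^sub>2\<^esub> w"
        using wc x by (auto simp: y_def)
      let ?z = "inv\<^bsub>G\<^sub>1\<^esub> x \<otimes>\<^bsub>G\<^sub>1\<^esub> y"
      have "B.Z (Suc n) #>\<^bsub>G\<^sub>2\<^esub> \<phi> x = B.Z (Suc n) #>\<^bsub>G\<^sub>2\<^esub> \<phi> y"
        using B.Z_eq_iff[of "\<phi> x" "\<phi> y" "Suc n"] x y w wc by simp
      then have "A.Z (Suc n) #>\<^bsub>G\<^sub>1\<^esub> x = A.Z (Suc n) #>\<^bsub>G\<^sub>1\<^esub> y"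
        by (rule coset_reflected[OF x y(1)])
      then have "?z \<in> A.Z (Suc n)"
        using A.Z_eq_iff[of x y "Suc n"] x y by blast
      then obtain d where d: "d \<in> B.Z (Suc n)"
        "\<And>x. x \<in> carrier G\<^sub>1 \<Longrightarrow> B.Z n #>\<^bsub>G\<^sub>2\<^esub> \<phi> (x \<otimes>\<^bsub>G\<^sub>1\<^esub> ?z) = B.Z n #>\<^bsub>G\<^sub>2\<^esub> (\<phi> x \<otimes>\<^bsub>G\<^sub>2\<^esub> d)"
        using central_shift[OF coset_preserved] by blast
      have dc: "d \<in> carrier G\<^sub>2"
        using d(1) B.Z_sub by blast
      \<comment> \<open>Evaluation at \<open>x\<close> identifies \<open>d\<close> with
        \<open>w\<close> modulo \<open>B.Z n\<close>.\<close>
      have "B.Z n #>\<^bsub>G\<^sub>2\<^esub> (\<phi> x \<otimes>\<^bsub>G\<^sub>2\<^esub> w) = B.Z n #>\<^bsub>G\<^sub>2\<^esub> (\<phi> x \<otimes>\<^bsub>G\<^sub>2\<^esub> d)"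
        using d(2)[OF x] x y by simp
      then have wd: "B.Z n #>\<^bsub>G\<^sub>2\<^esub> d = B.Z n #>\<^bsub>G\<^sub>2\<^esub> w"
        using B.Z_cong_cancel[of n "\<phi> x" w d] x wc dc by simp
      have "B.Z n #>\<^bsub>G\<^sub>2\<^esub> \<phi> (g \<otimes>\<^bsub>G\<^sub>1\<^esub> y) = B.Z n #>\<^bsub>G\<^sub>2\<^esub> (\<phi> (g \<otimes>\<^bsub>G\<^sub>1\<^esub> x) \<otimes>\<^bsub>G\<^sub>2\<^esub> d)"
        using d(2)[of "g \<otimes>\<^bsub>G\<^sub>1\<^esub> x"] g x y(1) by (simp add: A.m_assoc)
      also have "\<dots> = B.Z n #>\<^bsub>G\<^sub>2\<^esub> (\<phi> (g \<otimes>\<^bsub>G\<^sub>1\<^esub> x) \<otimes>\<^bsub>G\<^sub>2\<^esub> w)"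
        using wd g x wc dc by (intro B.Z_cong_mult) auto
      finally have "B.Z n #>\<^bsub>G\<^sub>2\<^esub> (inv\<^bsub>G\<^sub>2\<^esub> \<phi> g \<otimes>\<^bsub>G\<^sub>2\<^esub> \<phi> (g \<otimes>\<^bsub>G\<^sub>1\<^esub> y))
          = B.Z n #>\<^bsub>G\<^sub>2\<^esub> (inv\<^bsub>G\<^sub>2\<^esub> \<phi> g \<otimes>\<^bsub>G\<^sub>2\<^esub> (\<phi> (g \<otimes>\<^bsub>G\<^sub>1\<^esub> x) \<otimes>\<^bsub>G\<^sub>2\<^esub> w))"
        using g x y(1) wc by (intro B.Z_cong_mult) auto
      then show ?thesis
        using g x wc by (simp add: f_def y_def B.m_assoc)
    qed
    have fk: "(f ^^ k) y \<in> carrier G\<^sub>2" if "y \<in> carrier G\<^sub>2" for k y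
      using that fc by (induction k) auto
    have pw: "B.Z n #>\<^bsub>G\<^sub>2\<^esub> (f ^^ k) (\<phi> x) = B.Z n #>\<^bsub>G\<^sub>2\<^esub> (\<phi> x \<otimes>\<^bsub>G\<^sub>2\<^esub> D [^]\<^bsub>G\<^sub>2\<^esub> k)" for k
    proof (induction k)
      case (Suc k)
      \<comment> \<open>The displacement accumulated after \<open>k\<close> rounds; it is congruent
        to the \<open>k\<close>-th power of \<open>D\<close>, hence lies where
        \<open>f_shift\<close> applies.\<close>
      define w where "w = inv\<^bsub>G\<^sub>2\<^esub> \<phi> x \<otimes>\<^bsub>G\<^sub>2\<^esub> (f ^^ k) (\<phi> x)"
      have w: "w \<in> carrier G\<^sub>2" "(f ^^ k) (\<phi> x) = \<phi> x \<otimes>\<^bsub>G\<^sub>2\<^esub> w"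
        using x fk by (auto simp: w_def)
      have wD: "B.Z n #>\<^bsub>G\<^sub>2\<^esub> w = B.Z n #>\<^bsub>G\<^sub>2\<^esub> (D [^]\<^bsub>G\<^sub>2\<^esub> k)"
        using Suc B.Z_cong_cancel[of n "\<phi> x" w "D [^]\<^bsub>G\<^sub>2\<^esub> k"] w x Dc by simp
      have "w \<in> B.Z (Suc n)"
      proof -
        interpret Zn: normal "B.Z (Suc n)" G\<^sub>2
          by (rule B.Z_normal)
        have Dk: "D [^]\<^bsub>G\<^sub>2\<^esub> k \<in> B.Z (Suc n)"
          using D Zn.m_closed Zn.one_closed by (induction k) (simp_all del: upper_central.simps)
        have "inv\<^bsub>G\<^sub>2\<^esub> (D [^]\<^bsub>G\<^sub>2\<^esub> k) \<otimes>\<^bsub>G\<^sub>2\<^esub> w \<in> B.Z (Suc n)"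
          using B.Z_cong_mono[of n "Suc n" "D [^]\<^bsub>G\<^sub>2\<^esub> k" w] wD w(1) Dc
            B.Z_eq_iff[of "D [^]\<^bsub>G\<^sub>2\<^esub> k" w "Suc n"] by simp
        then have "D [^]\<^bsub>G\<^sub>2\<^esub> k \<otimes>\<^bsub>G\<^sub>2\<^esub> (inv\<^bsub>G\<^sub>2\<^esub> (D [^]\<^bsub>G\<^sub>2\<^esub> k) \<otimes>\<^bsub>G\<^sub>2\<^esub> w) \<in> B.Z (Suc n)"
          by (rule Zn.m_closed[OF Dk])
        then show ?thesis
          using w(1) Dc by simp
      qed
      then have "B.Z n #>\<^bsub>G\<^sub>2\<^esub> (f ^^ Suc k) (\<phi> x) = B.Z n #>\<^bsub>G\<^sub>2\<^esub> (\<phi> x \<otimes>\<^bsub>G\<^sub>2\<^esub> D \<otimes>\<^bsub>G\<^sub>2\<^esub> w)"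
        using f_shift[of w] by (simp add: w(2) f\<phi>x)
      also have "\<dots> = B.Z n #>\<^bsub>G\<^sub>2\<^esub> (\<phi> x \<otimes>\<^bsub>G\<^sub>2\<^esub> D \<otimes>\<^bsub>G\<^sub>2\<^esub> D [^]\<^bsub>G\<^sub>2\<^esub> k)"
        using wD x Dc w(1) by (intro B.Z_cong_mult) auto
      finally show ?case
        using x Dc B.nat_pow_Suc2[OF Dc, of k] by (simp add: B.m_assoc)
    qed (use x in simp)
    have "f \<one>\<^bsub>G\<^sub>2\<^esub> = \<one>\<^bsub>G\<^sub>2\<^esub>"
    proof -
      have "\<phi>' \<one>\<^bsub>G\<^sub>2\<^esub> = \<one>\<^bsub>G\<^sub>1\<^esub>"
        using \<phi>'_\<phi>[OF A.one_closed] one by simp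
      then show ?thesis
        using g by (simp add: f_def)
    qed
    then have fk1: "(f ^^ k) \<one>\<^bsub>G\<^sub>2\<^esub> = \<one>\<^bsub>G\<^sub>2\<^esub>" for k
      by (induction k) auto
    \<comment> \<open>All iterates of \<open>f\<close> are automorphisms fixing the identity, so
      \<open>(f ^^ k) (\<phi> x)\<close> is a displacement at the identity along
      \<open>\<phi> x\<close>; uniformity of \<open>F\<close> covers every \<open>k\<close>.\<close>
    obtain F where F: "finite F" "F \<subseteq> carrier G\<^sub>2" "\<And>\<theta> y. graph_isomorphism (Cay G\<^sub>2 S\<^sub>2) (Cay G\<^sub>2 S\<^sub>2) \<theta> \<Longrightarrow>
        y \<in> carrier G\<^sub>2 \<Longrightarrow> inv\<^bsub>G\<^sub>2\<^esub> \<theta> y \<otimes>\<^bsub>G\<^sub>2\<^esub> \<theta> (y \<otimes>\<^bsub>G\<^sub>2\<^esub> \<phi> x) \<in> F"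
      using Cay_isomorphism_finite_displacement[OF B.is_group B.is_group S\<^sub>2 S\<^sub>2 \<phi>_closed[OF x]] by blast
    have fkF: "(f ^^ k) (\<phi> x) \<in> F" for k
      using F(3)[OF graph_isomorphism_funpow[OF f_iso, of k] B.one_closed] fk1[of k] fk x by simp
    have "D \<in> B.Z n"
    proof (rule B.Z_finite_powers[OF Dc])
      show "finite ((\<lambda>y. inv\<^bsub>G\<^sub>2\<^esub> \<phi> x \<otimes>\<^bsub>G\<^sub>2\<^esub> y) ` F)"
        using F by simp
      fix k :: nat
      have "B.Z n #>\<^bsub>G\<^sub>2\<^esub> (inv\<^bsub>G\<^sub>2\<^esub> \<phi> x \<otimes>\<^bsub>G\<^sub>2\<^esub> (\<phi> x \<otimes>\<^bsub>G\<^sub>2\<^esub> D [^]\<^bsub>G\<^sub>2\<^esub> k))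
          = B.Z n #>\<^bsub>G\<^sub>2\<^esub> (inv\<^bsub>G\<^sub>2\<^esub> \<phi> x \<otimes>\<^bsub>G\<^sub>2\<^esub> (f ^^ k) (\<phi> x))"
        using pw[of k] x Dc fk by (intro B.Z_cong_mult) auto
      then show "\<exists>y\<in>(\<lambda>y. inv\<^bsub>G\<^sub>2\<^esub> \<phi> x \<otimes>\<^bsub>G\<^sub>2\<^esub> y) ` F. B.Z n #>\<^bsub>G\<^sub>2\<^esub> (D [^]\<^bsub>G\<^sub>2\<^esub> k) = B.Z n #>\<^bsub>G\<^sub>2\<^esub> y"
        using fkF[of k] x Dc by auto
    qed
    then have "inv\<^bsub>G\<^sub>2\<^esub> (\<phi> g \<otimes>\<^bsub>G\<^sub>2\<^esub> \<phi> x) \<otimes>\<^bsub>G\<^sub>2\<^esub> \<phi> (g \<otimes>\<^bsub>G\<^sub>1\<^esub> x) \<in> B.Z n"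
      using g x by (simp add: D_def f_def B.inv_mult_group B.m_assoc)
    then show ?case
      using B.Z_eq_iff[of "\<phi> g \<otimes>\<^bsub>G\<^sub>2\<^esub> \<phi> x" "\<phi> (g \<otimes>\<^bsub>G\<^sub>1\<^esub> x)" n] g x by simp
  qed
qed

end

text \<open>After a left translation the isomorphism fixes the identity. Level 0 of the series is
  the finite normal subgroup, where \<open>multiplicative_mod\<close> gives a homomorphism,
  \<open>coset_preserved\<close> its descent to the quotient and \<open>coset_reflected\<close>
  injectivity.\<close>

theorem theorem4p2:
  fixes G\<^sub>1 :: "('a, 'm) monoid_scheme" and G\<^sub>2 :: "('b, 'n) monoid_scheme"
    and S\<^sub>1 N\<^sub>1 :: "'a set" and S\<^sub>2 N\<^sub>2 :: "'b set"
    and \<phi> :: "'a \<Rightarrow> 'b"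
  assumes "group G\<^sub>1" and "group G\<^sub>2"
    and "symmetric_finite_generating_set G\<^sub>1 S\<^sub>1"
    and "symmetric_finite_generating_set G\<^sub>2 S\<^sub>2"
    and "N\<^sub>1 \<lhd> G\<^sub>1" and "finite N\<^sub>1"
    and "N\<^sub>2 \<lhd> G\<^sub>2" and "finite N\<^sub>2"
    and "torsion_free (G\<^sub>1 Mod N\<^sub>1)" and "nilpotent (G\<^sub>1 Mod N\<^sub>1)"
    and "torsion_free (G\<^sub>2 Mod N\<^sub>2)" and "nilpotent (G\<^sub>2 Mod N\<^sub>2)"
    and "graph_isomorphism (Cay G\<^sub>1 S\<^sub>1) (Cay G\<^sub>2 S\<^sub>2) \<phi>"
  shows "(\<forall>x \<in> carrier G\<^sub>1. \<forall>y \<in> carrier G\<^sub>1.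
            x <#\<^bsub>G\<^sub>1\<^esub> N\<^sub>1 = y <#\<^bsub>G\<^sub>1\<^esub> N\<^sub>1 \<longrightarrow> \<phi> x <#\<^bsub>G\<^sub>2\<^esub> N\<^sub>2 = \<phi> y <#\<^bsub>G\<^sub>2\<^esub> N\<^sub>2) \<and>
         (\<exists>\<psi> \<in> carrier (G\<^sub>1 Mod N\<^sub>1) \<rightarrow> carrier (G\<^sub>2 Mod N\<^sub>2).
            (\<forall>x \<in> carrier G\<^sub>1. \<psi> (x <#\<^bsub>G\<^sub>1\<^esub> N\<^sub>1) = \<phi> x <#\<^bsub>G\<^sub>2\<^esub> N\<^sub>2) \<and>
            affine_bijection (G\<^sub>1 Mod N\<^sub>1) (G\<^sub>2 Mod N\<^sub>2) \<psi>)"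
proof -
  interpret A: group G\<^sub>1 by fact
  interpret B: group G\<^sub>2 by fact
  have S\<^sub>2: "S\<^sub>2 \<subseteq> carrier G\<^sub>2"
    using assms(4) by (simp add: symmetric_finite_generating_set_def)
  have \<phi>c: "\<phi> x \<in> carrier G\<^sub>2" if "x \<in> carrier G\<^sub>1" for x
    using assms(13) that by (auto simp: graph_isomorphism_def dest: bij_betw_apply)
  define h where "h = \<phi> \<one>\<^bsub>G\<^sub>1\<^esub>"
  have hc: "h \<in> carrier G\<^sub>2"
    by (simp add: h_def \<phi>c)
  define \<theta> where "\<theta> x = inv\<^bsub>G\<^sub>2\<^esub> h \<otimes>\<^bsub>G\<^sub>2\<^esub> \<phi> x" for x
  have "graph_isomorphism (Cay G\<^sub>1 S\<^sub>1) (Cay G\<^sub>2 S\<^sub>2) \<theta>"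
    using graph_isomorphism_comp[OF assms(13) B.Cay_left_translation[OF S\<^sub>2, of "inv\<^bsub>G\<^sub>2\<^esub> h"]] hc
    by (simp add: o_def \<theta>_def[abs_def])
  then interpret \<theta>: cayley_isomorphism G\<^sub>1 N\<^sub>1 G\<^sub>2 N\<^sub>2 S\<^sub>1 S\<^sub>2 \<theta>
    using assms
    by (simp add: cayley_isomorphism_def cayley_isomorphism_axioms_def
        finite_by_torsion_free_nilpotent_def finite_by_torsion_free_nilpotent_axioms_def)
  interpret N\<^sub>1: normal N\<^sub>1 G\<^sub>1 by fact
  interpret N\<^sub>2: normal N\<^sub>2 G\<^sub>2 by fact
  interpret Q: group_hom G\<^sub>2 "G\<^sub>2 Mod N\<^sub>2" "r_coset G\<^sub>2 N\<^sub>2"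
    by (rule N\<^sub>2.quotient_hom)
  have \<theta>_one: "\<theta> \<one>\<^bsub>G\<^sub>1\<^esub> = \<one>\<^bsub>G\<^sub>2\<^esub>"
    using hc by (simp add: \<theta>_def h_def)
  have \<phi>_\<theta>: "\<phi> x = h \<otimes>\<^bsub>G\<^sub>2\<^esub> \<theta> x" if "x \<in> carrier G\<^sub>1" for x
    using that hc \<phi>c by (simp add: \<theta>_def)
  have hom: "(\<lambda>x. N\<^sub>2 #>\<^bsub>G\<^sub>2\<^esub> \<theta> x) \<in> hom G\<^sub>1 (G\<^sub>2 Mod N\<^sub>2)"
  proof (rule homI)
    fix x y assume xy: "x \<in> carrier G\<^sub>1" "y \<in> carrier G\<^sub>1"
    show "N\<^sub>2 #>\<^bsub>G\<^sub>2\<^esub> \<theta> x \<in> carrier (G\<^sub>2 Mod N\<^sub>2)"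
      using xy by (intro Q.hom_closed \<theta>.\<phi>_closed)
    show "N\<^sub>2 #>\<^bsub>G\<^sub>2\<^esub> \<theta> (x \<otimes>\<^bsub>G\<^sub>1\<^esub> y) = (N\<^sub>2 #>\<^bsub>G\<^sub>2\<^esub> \<theta> x) \<otimes>\<^bsub>G\<^sub>2 Mod N\<^sub>2\<^esub> (N\<^sub>2 #>\<^bsub>G\<^sub>2\<^esub> \<theta> y)"
      using \<theta>.multiplicative_mod[OF \<theta>_one xy, of 0] Q.hom_mult[OF \<theta>.\<phi>_closed[OF xy(1)] \<theta>.\<phi>_closed[OF xy(2)]]
      by (simp only: upper_central.simps)
  qed
  have cong: "N\<^sub>2 #>\<^bsub>G\<^sub>2\<^esub> \<theta> x = N\<^sub>2 #>\<^bsub>G\<^sub>2\<^esub> \<theta> y"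
    if "x \<in> carrier G\<^sub>1" "y \<in> carrier G\<^sub>1" "N\<^sub>1 #>\<^bsub>G\<^sub>1\<^esub> x = N\<^sub>1 #>\<^bsub>G\<^sub>1\<^esub> y" for x y
    using \<theta>.coset_preserved[of x y 0] that by simp
  obtain \<alpha> where \<alpha>: "\<alpha> \<in> hom (G\<^sub>1 Mod N\<^sub>1) (G\<^sub>2 Mod N\<^sub>2)"
    and \<alpha>_coset: "\<And>x. x \<in> carrier G\<^sub>1 \<Longrightarrow> \<alpha> (N\<^sub>1 #>\<^bsub>G\<^sub>1\<^esub> x) = N\<^sub>2 #>\<^bsub>G\<^sub>2\<^esub> \<theta> x"
    using FactGroup_universal[OF hom assms(5) cong] by blast
  have "inj_on \<alpha> (carrier (G\<^sub>1 Mod N\<^sub>1))"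
  proof (rule inj_onI)
    fix C D assume CD: "C \<in> carrier (G\<^sub>1 Mod N\<^sub>1)" "D \<in> carrier (G\<^sub>1 Mod N\<^sub>1)" "\<alpha> C = \<alpha> D"
    then obtain x y where "x \<in> carrier G\<^sub>1" "C = N\<^sub>1 #>\<^bsub>G\<^sub>1\<^esub> x" "y \<in> carrier G\<^sub>1" "D = N\<^sub>1 #>\<^bsub>G\<^sub>1\<^esub> y"
      unfolding carrier_FactGroup by blast
    then show "C = D"
      using \<theta>.coset_reflected[of x y 0] CD(3) by (simp add: \<alpha>_coset)
  qed
  moreover have "\<alpha> ` carrier (G\<^sub>1 Mod N\<^sub>1) = carrier (G\<^sub>2 Mod N\<^sub>2)"
  proof -
    have "\<alpha> ` carrier (G\<^sub>1 Mod N\<^sub>1) = (\<lambda>x. N\<^sub>2 #>\<^bsub>G\<^sub>2\<^esub> \<theta> x) ` carrier G\<^sub>1"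
      unfolding carrier_FactGroup image_image by (intro image_cong refl \<alpha>_coset)
    also have "\<dots> = r_coset G\<^sub>2 N\<^sub>2 ` (\<theta> ` carrier G\<^sub>1)"
      by (rule image_image[symmetric])
    also have "\<theta> ` carrier G\<^sub>1 = carrier G\<^sub>2"
      using \<theta>.\<phi>_bij by (rule bij_betw_imp_surj_on)
    finally show ?thesis
      by (simp only: carrier_FactGroup)
  qed
  ultimately have \<alpha>_iso: "\<alpha> \<in> iso (G\<^sub>1 Mod N\<^sub>1) (G\<^sub>2 Mod N\<^sub>2)"
    using \<alpha> by (simp add: iso_def bij_betw_def)
  define \<psi> where "\<psi> C = (N\<^sub>2 #>\<^bsub>G\<^sub>2\<^esub> h) \<otimes>\<^bsub>G\<^sub>2 Mod N\<^sub>2\<^esub> \<alpha> C" for C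
  \<comment> \<open>The statement uses left cosets; \<open>coset_eq\<close> identifies them with the
    right cosets used so far.\<close>
  have \<psi>_coset: "\<psi> (x <#\<^bsub>G\<^sub>1\<^esub> N\<^sub>1) = \<phi> x <#\<^bsub>G\<^sub>2\<^esub> N\<^sub>2" if x: "x \<in> carrier G\<^sub>1" for x
  proof -
    have "\<psi> (x <#\<^bsub>G\<^sub>1\<^esub> N\<^sub>1) = (N\<^sub>2 #>\<^bsub>G\<^sub>2\<^esub> h) \<otimes>\<^bsub>G\<^sub>2 Mod N\<^sub>2\<^esub> (N\<^sub>2 #>\<^bsub>G\<^sub>2\<^esub> \<theta> x)"
      using N\<^sub>1.coset_eq x \<alpha>_coset[OF x] by (simp only: \<psi>_def)
    also have "\<dots> = N\<^sub>2 #>\<^bsub>G\<^sub>2\<^esub> \<phi> x"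
      using Q.hom_mult[OF hc \<theta>.\<phi>_closed[OF x]] by (simp only: \<phi>_\<theta>[OF x])
    also have "\<dots> = \<phi> x <#\<^bsub>G\<^sub>2\<^esub> N\<^sub>2"
      using N\<^sub>2.coset_eq \<phi>c[OF x] by blast
    finally show ?thesis .
  qed
  have affine: "affine_bijection (G\<^sub>1 Mod N\<^sub>1) (G\<^sub>2 Mod N\<^sub>2) \<psi>"
    unfolding affine_bijection_def \<psi>_def using \<alpha>_iso Q.hom_closed[OF hc] by blast
  have \<psi>_closed: "\<psi> \<in> carrier (G\<^sub>1 Mod N\<^sub>1) \<rightarrow> carrier (G\<^sub>2 Mod N\<^sub>2)"
    unfolding \<psi>_def by (intro Pi_I Q.H.m_closed Q.hom_closed[OF hc] hom_in_carrier[OF \<alpha>])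
  \<comment> \<open>Since \<open>\<psi>\<close> is a function of the coset, equal cosets have equal
    images by \<open>\<psi>_coset\<close>.\<close>
  have well_defined: "\<phi> x <#\<^bsub>G\<^sub>2\<^esub> N\<^sub>2 = \<phi> y <#\<^bsub>G\<^sub>2\<^esub> N\<^sub>2"
    if "x \<in> carrier G\<^sub>1" "y \<in> carrier G\<^sub>1" "x <#\<^bsub>G\<^sub>1\<^esub> N\<^sub>1 = y <#\<^bsub>G\<^sub>1\<^esub> N\<^sub>1" for x y
    using \<psi>_coset[OF that(1)] \<psi>_coset[OF that(2)] that(3) by simp
  show ?thesis
    by (intro conjI ballI impI bexI[of _ \<psi>]) (fact well_defined \<psi>_coset affine \<psi>_closed)+
qed

end
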